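(* Let $(f,I,\mu)$ be a system as described in the context, with constants $d=d(\mu)$ and $D=D(\mu)$. There exist $p>0$ and $C>0$ such that, writing $\mathbf{C}_\delta=p\,\delta^{-D}\log(1/\delta)$, for all $\epsilon,\delta\in(0,1)$ there exists an $(\epsilon,\delta)$-multifractal discretisation $\mathcal{A}_{\delta,\epsilon}$ of $\mu$ such that $$\sum_{A\in\mathcal{A}_{\delta,\epsilon}}e^{-\mathbf{C}_\delta\,\mu(A)}\;\le\; C\,\epsilon^{-1/d}.$$
   Context: Setting. $I\subset\mathbb{R}$ is an interval with a finite partition $\mathcal{P}$ into intervals, and $f:I\to\mathbb{R}$ is a map such that for each $P\in\mathcal{P}$ the restriction $f:P\to I$ is $C^2$, uniformly expanding, and extends continuously to $\overline P$ so that $f:\overline P\to I$ is a diffeomorphism (full branches). For $n\in\mathbb{N}$ let $\mathcal{P}_n=\bigvee_{i=0}^{n-1}f^{-i}\mathcal{P}$, whose elements are called $n$-cylinders, and assume bounded distortion: $\sup_n\sup_{P\in\mathcal{P}_n}\sup_{x,y\in P}|Df^n(x)|/|Df^n(y)|<\infty$. (Boundary points of cylinders have measure zero and are ignored.) $\phi:I\to\mathbb{R}$ is a potential that is Hölder on each $P\in\mathcal{P}$, with $S_n\phi=\sum_{i=0}^{n-1}\phi\circ f^i$ and pressure $P(\phi)=\lim_{n\to\infty}\frac1n\log\sum_{f^nx=x}e^{S_n\phi(x)}$; replacing $\phi$ by $\phi-P(\phi)$ we assume $P(\phi)=0$. $\mu=\mu_\phi$ is the unique $f$-invariant Gibbs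 probability measure for $\phi$: there is $0<C'<\infty$ with $\frac1{C'}\le \mu(P)/e^{S_n\phi(x)}\le C'$ for all $n$, $P\in\mathcal{P}_n$, $x\in P$. The measure $\mu$ is fully supported on $I$ and is regarded as a Borel measure on $\mathbb{R}$ when convenient. The constants $d,D$ are $$d=\lim_{\delta\to0}\frac{\log\max_{x\in I}\mu(B(x,\delta))}{\log\delta},\qquad D=\lim_{\delta\to0}\frac{\log\min_{x\in I}\mu(B(x,\delta))}{\log\delta}$$ (the limits exist in this setting), where $B(x,\delta)$ is the ball of radius $\delta$ centred at $x$. An $(\epsilon,\delta)$-multifractal discretisation of $\mu$ is a collection $\mathcal{A}_{\delta,\epsilon}$ of (Borel) sets, each of diameter at least $\delta/2$, such that for any $\delta$-ball $B(x,\delta)$, $x\in I$, there exists $A\in\mathcal{A}_{\delta,\epsilon}$ with $A\subset B(x,\delta)$ and $\mu(A)/\mu(B(x,\delta))\ge1-\epsilon$. *)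

theory Defs
  imports "HOL-Probability.Probability"
begin

text \<open>
  All derivatives are taken within the set under consideration (an interval containing some, none
  or all of its endpoints), so that they are one-sided at endpoints.
\<close>

definition C2_on :: "real set \<Rightarrow> (real \<Rightarrow> real) \<Rightarrow> bool" where
  "C2_on S f \<longleftrightarrow> (\<exists>f' f''.
     (\<forall>x\<in>S. (f has_real_derivative f' x) (at x within S)) \<and>
     (\<forall>x\<in>S. (f' has_real_derivative f'' x) (at x within S)) \<and>
     continuous_on S f'')"

definition C1_on :: "real set \<Rightarrow> (real \<Rightarrow> real) \<Rightarrow> bool" where
  "C1_on S f \<longleftrightarrow> (\<exists>f'. (\<forall>x\<in>S. (f has_real_derivative f' x) (at x within S)) \<and>
     continuous_on S f')"

definition diffeomorphism_on :: "real set \<Rightarrow> real set \<Rightarrow> (real \<Rightarrow> real) \<Rightarrow> bool" where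
  "diffeomorphism_on S T g \<longleftrightarrow> bij_betw g S T \<and> C1_on S g \<and> C1_on T (inv_into S g)"

definition holder_on :: "real set \<Rightarrow> (real \<Rightarrow> real) \<Rightarrow> bool" where
  "holder_on S \<phi> \<longleftrightarrow> (\<exists>\<alpha> K. 0 < \<alpha> \<and> \<alpha> \<le> 1 \<and>
     (\<forall>x\<in>S. \<forall>y\<in>S. \<bar>\<phi> x - \<phi> y\<bar> \<le> K * \<bar>x - y\<bar> powr \<alpha>))"

text \<open>The elements of the join of \<open>f\<^sup>-\<^sup>i \<P>\<close> for \<open>i < n\<close>; in particular \<open>I\<close> is the only 0-cylinder.\<close>

definition cylinders :: "real set \<Rightarrow> real set set \<Rightarrow> (real \<Rightarrow> real) \<Rightarrow> nat \<Rightarrow> real set set" where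
  "cylinders I \<P> f n = {Q. Q \<noteq> {} \<and>
     (\<exists>w. (\<forall>i<n. w i \<in> \<P>) \<and> Q = {x\<in>I. \<forall>i<n. (f ^^ i) x \<in> w i})}"

definition birkhoff_sum :: "(real \<Rightarrow> real) \<Rightarrow> nat \<Rightarrow> (real \<Rightarrow> real) \<Rightarrow> real \<Rightarrow> real" where
  "birkhoff_sum f n \<phi> x = (\<Sum>i<n. \<phi> ((f ^^ i) x))"

text \<open>
  For the maps considered below, \<open>f ^^ n\<close> has at most one fixed point in each of the finitely many
  \<open>n\<close>-cylinders (\<open>n > 0\<close>), so the sum is finite.
\<close>

definition has_pressure :: "real set \<Rightarrow> (real \<Rightarrow> real) \<Rightarrow> (real \<Rightarrow> real) \<Rightarrow> real \<Rightarrow> bool" where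
  "has_pressure I f \<phi> p \<longleftrightarrow>
     (\<lambda>n. 1 / real n * ln (\<Sum>x\<in>{x\<in>I. (f ^^ n) x = x}. exp (birkhoff_sum f n \<phi> x)))
       \<longlonglongrightarrow> p"

locale full_branch_map =
  fixes I :: "real set" and \<P> :: "real set set" and f :: "real \<Rightarrow> real"
  assumes interval: "is_interval I" "interior I \<noteq> {}"
    and partition: "finite \<P>" "partition_on I \<P>" "\<And>P. P \<in> \<P> \<Longrightarrow> is_interval P"
    and self_map: "f \<in> I \<rightarrow> I"
    and C2: "\<And>P. P \<in> \<P> \<Longrightarrow> C2_on P f"
    and expanding:
      "\<exists>\<kappa>>1. \<forall>P\<in>\<P>. \<forall>x\<in>P. \<kappa> \<le> \<bar>vector_derivative f (at x within P)\<bar>"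
    and full_branches:
      "\<And>P. P \<in> \<P> \<Longrightarrow> \<exists>g. (\<forall>x\<in>P. g x = f x) \<and> diffeomorphism_on (closure P) I g"
    and bounded_distortion:
      "\<exists>K. \<forall>n. \<forall>Q\<in>cylinders I \<P> f n. \<forall>x\<in>Q. \<forall>y\<in>Q.
         \<bar>vector_derivative (f ^^ n) (at x within Q)\<bar> /
         \<bar>vector_derivative (f ^^ n) (at y within Q)\<bar> \<le> K"

text \<open>
  The measure lives on the real line and is carried by \<open>I\<close>; the values of \<open>f\<close> and \<open>\<phi>\<close> outside
  \<open>I\<close> are irrelevant.
\<close>

locale gibbs_system = full_branch_map I \<P> f
  for I :: "real set" and \<P> :: "real set set" and f :: "real \<Rightarrow> real" +
  fixes \<phi> :: "real \<Rightarrow> real" and \<mu> :: "real measure"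
  assumes holder: "\<And>P. P \<in> \<P> \<Longrightarrow> holder_on P \<phi>"
    and pressure_zero: "has_pressure I f \<phi> 0"
    and prob: "prob_space \<mu>" "sets \<mu> = sets borel" "measure \<mu> I = 1"
    and invariant: "\<And>A. A \<in> sets borel \<Longrightarrow> measure \<mu> {x\<in>I. f x \<in> A} = measure \<mu> A"
    and gibbs:
      "\<exists>C'>0. \<forall>n. \<forall>Q\<in>cylinders I \<P> f n. \<forall>x\<in>Q.
         1 / C' \<le> measure \<mu> Q / exp (birkhoff_sum f n \<phi> x) \<and>
         measure \<mu> Q / exp (birkhoff_sum f n \<phi> x) \<le> C'"
    and full_support: "\<And>U. open U \<Longrightarrow> U \<inter> I \<noteq> {} \<Longrightarrow> 0 < measure \<mu> U"
    and boundary_null: "\<And>n Q. Q \<in> cylinders I \<P> f n \<Longrightarrow> measure \<mu> (frontier Q) = 0"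

text \<open>
  The library's \<open>diameter\<close> is meaningful for bounded sets only; an unbounded set has infinite
  diameter and hence satisfies the lower bound.
\<close>

definition multifractal_discretisation ::
    "real set \<Rightarrow> real measure \<Rightarrow> real \<Rightarrow> real \<Rightarrow> real set set \<Rightarrow> bool" where
  "multifractal_discretisation I \<mu> \<epsilon> \<delta> \<A> \<longleftrightarrow>
     (\<forall>A\<in>\<A>. A \<in> sets borel \<and> (bounded A \<longrightarrow> \<delta> / 2 \<le> diameter A)) \<and>
     (\<forall>x\<in>I. \<exists>A\<in>\<A>. A \<subseteq> ball x \<delta> \<and> 1 - \<epsilon> \<le> measure \<mu> A / measure \<mu> (ball x \<delta>))"

end

theory Submission
  imports Defs
begin

text \<open>
  A set of mass at least \<open>c * \<delta> powr D\<close> has weight at most \<open>\<delta> powr (p * c)\<close> in the sum, so that a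
  family of such sets may have any number of members that is polynomial in \<open>1 / \<delta>\<close>: a large \<open>p\<close>
  absorbs it. Only the dependence on \<open>\<epsilon>\<close> needs care. The family consists of the balls of radius
  \<open>\<delta> - \<eta>\<close> around the multiples of a small \<open>\<eta>\<close>. Passing from a \<open>\<delta>\<close>-ball to the nearest of them
  loses only mass carried by two intervals of length \<open>O(\<eta>)\<close>, that is \<open>O(\<eta> powr d)\<close>, whereas the
  \<open>\<delta>\<close>-ball has mass at least \<open>c * \<delta> powr D\<close>. So \<open>\<eta>\<close> may be a small multiple of
  \<open>\<epsilon> powr (1 / d) * \<delta> powr s\<close> with \<open>s * d \<ge> D\<close>, and then there are only
  \<open>O(1 / \<eta>) = O(\<epsilon> powr (- 1 / d) * \<delta> powr (- s))\<close> balls in the family. This is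
  \<open>discretisation_of_power_bounds\<close>, which rests on the two bounds
  \<open>c\<^sub>1 * r powr D \<le> \<mu> (ball x r)\<close> for \<open>x \<in> I\<close> and \<open>\<mu> (ball x r) \<le> c\<^sub>2 * r powr d\<close> for all \<open>x\<close>.

  The dynamics serves to prove these two bounds with the exact exponents; the limits that define
  \<open>d\<close> and \<open>D\<close> alone would leave an error \<open>r powr o(1)\<close>. Length and mass of cylinders are both
  multiplicative up to a constant factor under concatenation of words, by bounded distortion
  (\<open>diameter_concat\<close>) and by the Gibbs property (\<open>mass_concat\<close>). Hence the cylinder of the
  \<open>k\<close>-fold repetition of a word has as length and mass the \<open>k\<close>-th powers of those of the word, up
  to \<open>K ^ k\<close>. Feeding these cylinders into the limits and dividing by \<open>k\<close> turns the limits into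
  inequalities for each single cylinder (\<open>mass_le_length_powr_d\<close>, \<open>mass_ge_length_powr_D\<close>). They pass
  to balls because a ball of radius \<open>r\<close> meets a bounded number of cylinders of length comparable
  to \<open>r\<close> that cover it (\<open>ball_mass_upper\<close>), and contains one if its centre is in \<open>I\<close>
  (\<open>ball_mass_lower\<close>).

  Two qualitative facts come before that: there are at least two branches, which makes masses
  decay exponentially and gives \<open>d > 0\<close>, and \<open>I\<close> is compact, so that lengths are finite and balls
  of a given radius have masses bounded away from \<open>0\<close>.
\<close>

section \<open>Lengths of intervals\<close>

lemma bounded_real_subset_Icc:
  fixes S :: "real set"
  assumes "bounded S" "S \<noteq> {}"
  shows "S \<subseteq> {Inf S..Sup S}" "Sup S - Inf S = diameter S" "Inf S \<le> Sup S"
proof -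
  have bdd: "bdd_above S" "bdd_below S"
    using assms(1) by (auto simp: bounded_imp_bdd_above bounded_imp_bdd_below)
  show sub: "S \<subseteq> {Inf S..Sup S}"
    using bdd by (auto intro: cInf_lower cSup_upper)
  then show le: "Inf S \<le> Sup S" using assms(2) by fastforce
  have "dist (Inf S) (Sup S) \<le> diameter (closure S)"
    using assms bdd by (intro diameter_bounded_bound bounded_closure
      closure_contains_Inf closure_contains_Sup) auto
  moreover have "diameter S \<le> diameter {Inf S..Sup S}"
    using sub by (intro diameter_subset) auto
  ultimately show "Sup S - Inf S = diameter S"
    using le assms(1) by (auto simp: diameter_closure dist_real_def)
qed

lemma is_interval_contains_Ioo:
  fixes S :: "real set"
  assumes "is_interval S" "S \<noteq> {}" "bounded S"
  shows "{Inf S<..<Sup S} \<subseteq> S"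
proof
  fix z assume z: "z \<in> {Inf S<..<Sup S}"
  have bdd: "bdd_above S" "bdd_below S"
    using assms(3) by (auto simp: bounded_imp_bdd_above bounded_imp_bdd_below)
  obtain a where a: "a \<in> S" "a < z" using z cInf_less_iff[OF assms(2) bdd(2)] by auto
  obtain b where b: "b \<in> S" "z < b" using z less_cSup_iff[OF assms(2) bdd(1)] by auto
  show "z \<in> S" using assms(1) a b by (meson is_interval_1 less_imp_le)
qed

lemma bounded_borel_fmeasurable:
  fixes S :: "real set"
  assumes "bounded S" "S \<in> sets borel"
  shows "S \<in> fmeasurable lborel"
  using assms fmeasurable_compact[of "closure S"] fmeasurableI2[of "closure S" lborel S]
  by (auto simp: compact_closure closure_subset)

lemma measure_lborel_le_diameter:
  fixes S :: "real set"
  assumes "bounded S"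
  shows "measure lborel S \<le> diameter S"
proof (cases "S = {} \<or> S \<notin> sets lborel")
  case True
  then show ?thesis using assms by (auto simp: diameter_ge_0 measure_notin_sets)
next
  case False
  then have S: "S \<noteq> {}" "S \<in> sets lborel" by auto
  note facts = bounded_real_subset_Icc[OF assms S(1)]
  have "measure lborel S \<le> measure lborel {Inf S..Sup S}"
    using facts(1) S(2) by (intro measure_mono_fmeasurable bounded_borel_fmeasurable) auto
  then show ?thesis using facts by simp
qed

lemma measure_lborel_interval:
  fixes S :: "real set"
  assumes "bounded S" "is_interval S"
  shows "measure lborel S = diameter S"
proof (cases "S = {}")
  case False
  note facts = bounded_real_subset_Icc[OF assms(1) False]
  have S: "S \<in> sets borel" using assms(2) by (rule real_interval_borel_measurable)
  have "S \<in> fmeasurable lborel"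
    using assms(1) S by (rule bounded_borel_fmeasurable)
  then have "measure lborel {Inf S<..<Sup S} \<le> measure lborel S"
    using is_interval_contains_Ioo[OF assms(2) False assms(1)] by (intro measure_mono_fmeasurable) auto
  then show ?thesis using facts measure_lborel_le_diameter[OF assms(1)] by simp
qed simp

text \<open>
  Finite sets are Lebesgue null, and Lebesgue measure is length on intervals. The finitely many
  missing points are those that a branch omits from its image \<open>I\<close> when \<open>P\<close> lacks an endpoint.
\<close>

lemma diameter_interval_minus_finite:
  fixes S F :: "real set"
  assumes "bounded S" "is_interval S" "finite F" "S - F \<subseteq> T" "T \<subseteq> S"
  shows "diameter T = diameter S"
proof (rule antisym)
  show "diameter T \<le> diameter S" using assms by (intro diameter_subset) auto
  have "F \<in> null_sets lborel" using assms(3) by (simp add: finite_imp_null_set_lborel)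
  moreover have "S \<in> sets lborel" using assms(2) real_interval_borel_measurable by auto
  ultimately have "measure lborel (S - F) = measure lborel S"
    by (simp add: measure_Diff_null_set)
  moreover have "measure lborel (S - F) \<le> diameter (S - F)"
    using assms(1) by (intro measure_lborel_le_diameter) (auto intro: bounded_diff)
  moreover have "diameter (S - F) \<le> diameter T"
    using assms bounded_subset[OF assms(1,5)] by (intro diameter_subset) auto
  ultimately show "diameter S \<le> diameter T"
    using measure_lborel_interval[OF assms(1,2)] by simp
qed

lemma diameter_pos_of_infinite:
  fixes S :: "real set"
  assumes "infinite S" "bounded S"
  shows "0 < diameter S"
proof -
  obtain x where x: "x \<in> S" using infinite_imp_nonempty[OF assms(1)] by blast
  have "infinite (S - {x})" using assms(1) by simp
  then obtain y where "y \<in> S - {x}" using infinite_imp_nonempty by blast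
  then have y: "y \<in> S" "y \<noteq> x" by auto
  have "dist x y \<le> diameter S" using x y assms by (intro diameter_bounded_bound) auto
  moreover have "0 < dist x y" using y by simp
  ultimately show ?thesis by linarith
qed

text \<open>
  A comparison of total lengths: the intervals are disjoint, so that their lengths add up to at most
  that of the ball.
\<close>

lemma card_disjoint_long_intervals:
  fixes \<Q> :: "real set set"
  assumes "disjoint \<Q>" and long: "\<And>Q. Q \<in> \<Q> \<Longrightarrow> is_interval Q \<and> Q \<subseteq> ball x R \<and> s \<le> diameter Q"
    and "0 < s" "0 < R"
  shows "finite \<Q> \<and> real (card \<Q>) \<le> 2 * R / s"
proof -
  have bound: "real (card G) \<le> 2 * R / s" if G: "G \<subseteq> \<Q>" "finite G" for G
  proof -
    have Q: "bounded Q" "is_interval Q" "Q \<in> fmeasurable lborel" "s \<le> measure lborel Q"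
      if "Q \<in> G" for Q
    proof -
      have Q: "is_interval Q \<and> Q \<subseteq> ball x R" using long[of Q] that G by blast
      then show b: "bounded Q" and i: "is_interval Q"
        using bounded_subset[OF bounded_ball, of Q x R] by blast+
      show "Q \<in> fmeasurable lborel"
        using b real_interval_borel_measurable[OF i] by (rule bounded_borel_fmeasurable)
      show "s \<le> measure lborel Q"
        using long[of Q] that G measure_lborel_interval[OF b i] by auto
    qed
    have "real (card G) * s \<le> (\<Sum>Q\<in>G. measure lborel Q)"
      using sum_mono[of G "\<lambda>_. s" "measure lborel"] Q by simp
    also have "\<dots> = measure lborel (\<Union>G)"
    proof (rule measure_Union'[symmetric])
      show "disjoint G" using assms(1) G(1) by (meson pairwise_subset)
    qed (use Q G in auto)
    also have "\<dots> \<le> measure lborel (ball x R)"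
    proof (rule measure_mono_fmeasurable)
      show "\<Union>G \<subseteq> ball x R" using long G(1) by blast
      show "\<Union>G \<in> sets lborel" using fmeasurableD[OF Q(3)] G(2) by (intro sets.finite_Union) auto
      show "ball x R \<in> fmeasurable lborel" by (intro bounded_borel_fmeasurable) auto
    qed
    also have "\<dots> = 2 * R" using \<open>0 < R\<close> by (simp add: ball_eq_greaterThanLessThan)
    finally show ?thesis using \<open>0 < s\<close> by (simp add: pos_le_divide_eq)
  qed
  then have "card G \<le> nat \<lfloor>2 * R / s\<rfloor>" if "G \<subseteq> \<Q>" "finite G" for G
    using that by (simp add: le_nat_floor)
  then have "finite \<Q> \<and> card \<Q> \<le> nat \<lfloor>2 * R / s\<rfloor>"
    by (rule finite_if_finite_subsets_card_bdd)
  then show ?thesis using bound[of \<Q>] by auto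
qed

lemma closure_interval_minus_finite:
  fixes S :: "real set"
  assumes "is_interval S"
  shows "finite (closure S - S)"
proof -
  have "z = Sup S \<or> z = Inf S" if z: "z \<in> closure S" "z \<notin> S" for z
  proof (cases "\<exists>a\<in>S. z < a")
    case False
    then have ub: "p \<le> z" if "p \<in> S" for p using that by force
    have "S \<noteq> {}" using z by auto
    then have "Sup S = z"
    proof (rule cSup_eq_non_empty[OF _ ub])
      fix y assume "\<And>x. x \<in> S \<Longrightarrow> x \<le> y"
      then have "closure S \<subseteq> {..y}" by (intro closure_minimal) auto
      then show "z \<le> y" using z by auto
    qed
    then show ?thesis by simp
  next
    case True
    then obtain a where a: "a \<in> S" "z < a" by auto
    have lb: "z \<le> p" if p: "p \<in> S" for p
    proof (rule ccontr)
      assume "\<not> z \<le> p"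
      then have "p \<le> z \<and> z \<le> a" using a by simp
      then show False using assms p a(1) z(2) unfolding is_interval_1 by blast
    qed
    have "S \<noteq> {}" using z by auto
    then have "Inf S = z"
    proof (rule cInf_eq_non_empty[OF _ lb])
      fix y assume "\<And>x. x \<in> S \<Longrightarrow> y \<le> x"
      then have "closure S \<subseteq> {y..}" by (intro closure_minimal) auto
      then show "y \<le> z" using z by auto
    qed
    then show ?thesis by simp
  qed
  then have "closure S - S \<subseteq> {Sup S, Inf S}" by blast
  then show ?thesis by (rule finite_subset) simp
qed

section \<open>Cylinders indexed by words\<close>

context full_branch_map
begin

text \<open>
  Words make concatenation, and with it the product structure of cylinders, explicit. A word over
  \<open>\<P>\<close> always has a nonempty cylinder (\<open>cyl_nonempty\<close> below), so that these are exactly the cylinders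
  of the system.
\<close>

definition cyl :: "real set list \<Rightarrow> real set" where
  "cyl ws = {x \<in> I. \<forall>i<length ws. (f ^^ i) x \<in> ws ! i}"

lemma iterate_mem: "x \<in> I \<Longrightarrow> (f ^^ n) x \<in> I"
  using self_map by (induction n) auto

lemma cyl_subset: "cyl ws \<subseteq> I"
  by (auto simp: cyl_def)

lemma cyl_Nil [simp]: "cyl [] = I"
  by (simp add: cyl_def)

lemma cyl_append: "cyl (us @ vs) = {x \<in> cyl us. (f ^^ length us) x \<in> cyl vs}" (is "?L = ?R")
proof (intro equalityI subsetI)
  fix x assume x: "x \<in> ?L"
  have "(f ^^ i) x \<in> us ! i" if "i < length us" for i
  proof -
    have "(f ^^ i) x \<in> (us @ vs) ! i" using x that by (auto simp: cyl_def)
    then show ?thesis using that by (simp add: nth_append)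
  qed
  then have "x \<in> cyl us" using x by (auto simp: cyl_def)
  moreover have "(f ^^ i) ((f ^^ length us) x) \<in> vs ! i" if "i < length vs" for i
  proof -
    have "(f ^^ (i + length us)) x \<in> (us @ vs) ! (i + length us)" using x that by (auto simp: cyl_def)
    then show ?thesis by (simp add: funpow_add nth_append)
  qed
  ultimately show "x \<in> ?R" using iterate_mem by (auto simp: cyl_def)
next
  fix x assume x: "x \<in> ?R"
  have "(f ^^ i) x \<in> (us @ vs) ! i" if i: "i < length (us @ vs)" for i
  proof (cases "i < length us")
    case True
    then show ?thesis using x by (auto simp: cyl_def nth_append)
  next
    case False
    then obtain j where j: "i = j + length us" by (metis add.commute le_Suc_ex not_less)
    then have "(f ^^ j) ((f ^^ length us) x) \<in> vs ! j" using x i by (auto simp: cyl_def)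
    then show ?thesis by (simp add: j funpow_add nth_append)
  qed
  then show "x \<in> ?L" using x by (auto simp: cyl_def)
qed

lemma cyl_single: "P \<in> \<P> \<Longrightarrow> cyl [P] = P"
  using partition(2) by (auto simp: cyl_def partition_on_def)

lemma cyl_Cons: "P \<in> \<P> \<Longrightarrow> cyl (P # ws) = {x \<in> P. f x \<in> cyl ws}"
  using cyl_append[of "[P]" ws] by (simp add: cyl_single)

lemma cyl_append_subset: "cyl (us @ vs) \<subseteq> cyl us"
  by (auto simp: cyl_append)

lemma cyl_in_cylinders:
  "ws \<in> lists \<P> \<Longrightarrow> cyl ws \<noteq> {} \<Longrightarrow> cyl ws \<in> cylinders I \<P> f (length ws)"
  unfolding cylinders_def cyl_def by (auto intro!: exI[of _ "(!) ws"])

lemma element_subset: "P \<in> \<P> \<Longrightarrow> P \<subseteq> I"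
  using partition(2) by (auto simp: partition_on_def)

lemma element_disjoint: "P \<in> \<P> \<Longrightarrow> P' \<in> \<P> \<Longrightarrow> x \<in> P \<Longrightarrow> x \<in> P' \<Longrightarrow> P = P'"
  using partition(2) by (auto simp: partition_on_def disjoint_def)

definition itinerary :: "real \<Rightarrow> nat \<Rightarrow> real set list" where
  "itinerary x n = map (\<lambda>i. THE P. P \<in> \<P> \<and> (f ^^ i) x \<in> P) [0..<n]"

lemma length_itinerary [simp]: "length (itinerary x n) = n"
  by (simp add: itinerary_def)

lemma the_element:
  assumes "x \<in> I"
  shows "(THE P. P \<in> \<P> \<and> x \<in> P) \<in> \<P> \<and> x \<in> (THE P. P \<in> \<P> \<and> x \<in> P)"
proof (rule theI')
  show "\<exists>!P. P \<in> \<P> \<and> x \<in> P"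
  proof -
    obtain P where "P \<in> \<P>" "x \<in> P" using assms partition(2) by (auto simp: partition_on_def)
    then show ?thesis using element_disjoint by blast
  qed
qed

lemma itinerary_in_lists: "x \<in> I \<Longrightarrow> itinerary x n \<in> lists \<P>"
  using the_element[OF iterate_mem] by (auto simp: itinerary_def)

lemma mem_cyl_itinerary: "x \<in> I \<Longrightarrow> x \<in> cyl (itinerary x n)"
  using the_element[OF iterate_mem] by (auto simp: itinerary_def cyl_def)

lemma itinerary_eqI:
  assumes "ws \<in> lists \<P>" "x \<in> cyl ws"
  shows "itinerary x (length ws) = ws"
proof (rule nth_equalityI)
  fix i assume "i < length (itinerary x (length ws))"
  then have i: "i < length ws" by simp
  then have "(THE P. P \<in> \<P> \<and> (f ^^ i) x \<in> P) = ws ! i"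
  proof (intro the_equality)
    show *: "ws ! i \<in> \<P> \<and> (f ^^ i) x \<in> ws ! i" using assms i by (auto simp: cyl_def)
    show "P = ws ! i" if "P \<in> \<P> \<and> (f ^^ i) x \<in> P" for P
      using element_disjoint that * by blast
  qed
  then show "itinerary x (length ws) ! i = ws ! i" using i by (simp add: itinerary_def)
qed simp

lemma itinerary_prefix: "k \<le> n \<Longrightarrow> itinerary x k = take k (itinerary x n)"
  by (simp add: itinerary_def take_map)

lemma itinerary_Suc: "x \<in> I \<Longrightarrow> \<exists>P\<in>\<P>. itinerary x (Suc n) = itinerary x n @ [P]"
  using the_element[OF iterate_mem, of x n] by (auto simp: itinerary_def)

section \<open>Iterates on cylinders\<close>

lemma infinite_I: "infinite I"
proof
  assume fin: "finite I"
  obtain x where "x \<in> interior I" using interval(2) by blast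
  then obtain e where "0 < e" "ball x e \<subseteq> I" unfolding mem_interior by blast
  then have "finite {x - e<..<x + e}"
    using finite_subset[OF _ fin] by (simp add: ball_eq_greaterThanLessThan)
  then show False using \<open>0 < e\<close> by (simp add: infinite_Ioo)
qed

lemma element_infinite: "P \<in> \<P> \<Longrightarrow> infinite P"
proof
  assume P: "P \<in> \<P>" "finite P"
  obtain g where "bij_betw g (closure P) I"
    using full_branches[OF P(1)] by (auto simp: diffeomorphism_on_def)
  moreover have "finite (closure P)" using P(2) by (simp add: finite_imp_closed)
  ultimately show False using infinite_I bij_betw_finite by blast
qed

lemma element_inj: "P \<in> \<P> \<Longrightarrow> inj_on f P"
proof -
  assume P: "P \<in> \<P>"
  obtain g where g: "\<forall>x\<in>P. g x = f x" "bij_betw g (closure P) I"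
    using full_branches[OF P] by (auto simp: diffeomorphism_on_def)
  have "inj_on g P" using g(2) closure_subset by (metis bij_betw_imp_inj_on inj_on_subset)
  then show ?thesis using g(1) by (simp add: inj_on_def)
qed

lemma element_has_derivative:
  assumes "P \<in> \<P>" "x \<in> P"
  shows "(f has_real_derivative vector_derivative f (at x within P)) (at x within P)"
proof -
  obtain f' where f': "(f has_real_derivative f') (at x within P)"
    using C2[OF assms(1)] assms(2) by (auto simp: C2_on_def)
  have "x islimpt P"
    using assms partition(3) element_infinite
    by (intro connected_imp_perfect) (auto simp: is_interval_connected)
  then have "vector_derivative f (at x within P) = f'"
    using f' by (intro vector_derivative_within)
      (auto simp: trivial_limit_within has_real_derivative_iff_has_vector_derivative)
  then show ?thesis using f' by simp
qed

lemma element_continuous: "P \<in> \<P> \<Longrightarrow> continuous_on P f"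
  using element_has_derivative by (meson DERIV_continuous_on)

lemma element_image_cofinite: "P \<in> \<P> \<Longrightarrow> finite (I - f ` P)"
proof -
  assume P: "P \<in> \<P>"
  obtain g where g: "\<forall>x\<in>P. g x = f x" "bij_betw g (closure P) I"
    using full_branches[OF P] by (auto simp: diffeomorphism_on_def)
  have "I - f ` P \<subseteq> g ` (closure P - P)"
    using g by (force simp: bij_betw_def)
  moreover have "finite (closure P - P)"
    using closure_interval_minus_finite partition(3)[OF P] by blast
  ultimately show ?thesis by (meson finite_imageI finite_subset)
qed

text \<open>
  Each branch maps onto \<open>I\<close> up to finitely many points, and this property survives composition:
  the points missed by the iterate are those missed by the later branches and the images of those
  missed by the first one.
\<close>

lemma iterate_image_cofinite:
  assumes "ws \<in> lists \<P>"
  shows "finite (I - (f ^^ length ws) ` cyl ws)"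
  using assms
proof (induction ws)
  case (Cons P ws)
  have "I - (f ^^ length (P # ws)) ` cyl (P # ws)
      \<subseteq> (I - (f ^^ length ws) ` cyl ws) \<union> (f ^^ length ws) ` (I - f ` P)"
  proof
    fix y assume y: "y \<in> I - (f ^^ length (P # ws)) ` cyl (P # ws)"
    show "y \<in> (I - (f ^^ length ws) ` cyl ws) \<union> (f ^^ length ws) ` (I - f ` P)"
    proof (cases "y \<in> (f ^^ length ws) ` cyl ws")
      case True
      then obtain z where z: "z \<in> cyl ws" "y = (f ^^ length ws) z" by auto
      have "z \<notin> f ` P"
      proof
        assume "z \<in> f ` P"
        then obtain x where "x \<in> P" "z = f x" by auto
        then have "x \<in> cyl (P # ws)" "y = (f ^^ length (P # ws)) x"
          using z Cons.hyps by (auto simp: cyl_Cons funpow_swap1)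
        then show False using y by blast
      qed
      then show ?thesis using z cyl_subset by auto
    qed (use y in auto)
  qed
  then show ?case
    using Cons by (elim finite_subset) (auto intro: element_image_cofinite)
qed simp

lemma cyl_infinite: "ws \<in> lists \<P> \<Longrightarrow> infinite (cyl ws)"
  using iterate_image_cofinite infinite_I
  by (metis Diff_infinite_finite finite_Diff2 finite_imageI)

lemma cyl_nonempty: "ws \<in> lists \<P> \<Longrightarrow> cyl ws \<noteq> {}"
  using cyl_infinite by fastforce

text \<open>
  By induction along the word: a branch is continuous and injective on an interval, hence strictly
  monotone, and so it pulls intervals back to intervals.
\<close>

lemma cyl_interval: "ws \<in> lists \<P> \<Longrightarrow> is_interval (cyl ws)"
proof (induction ws)
  case (Cons P ws)
  then have P: "P \<in> \<P>" and ws: "is_interval (cyl ws)" by auto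
  show ?case unfolding is_interval_1
  proof (intro ballI allI impI)
    fix a b x assume a: "a \<in> cyl (P # ws)" and b: "b \<in> cyl (P # ws)" and x: "a \<le> x \<and> x \<le> b"
    show "x \<in> cyl (P # ws)"
    proof (cases "x = a \<or> x = b")
      case False
      then have x': "a < x" "x < b" using x by auto
      have sub: "{a..b} \<subseteq> P"
        using a b partition(3)[OF P] unfolding cyl_Cons[OF P] is_interval_1 by auto
      have "f a < f x \<and> f x < f b \<or> f b < f x \<and> f x < f a"
        using x' continuous_on_subset[OF element_continuous[OF P] sub]
          inj_on_subset[OF element_inj[OF P] sub]
        by (intro continuous_inj_imp_mono)
      moreover have "f a \<in> cyl ws" "f b \<in> cyl ws" using a b by (auto simp: cyl_Cons[OF P])
      ultimately have "f x \<in> cyl ws" using ws unfolding is_interval_1 by (meson less_imp_le)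
      then show ?thesis using sub x by (auto simp: cyl_Cons[OF P])
    qed (use a b in auto)
  qed
qed (use interval(1) in simp)

text \<open>
  The chain rule gives the derivative of the iterate within the cylinder as a product of derivatives of
  branches. The bound in terms of the expansion constant makes it nonzero, without which the quotients
  in the distortion hypothesis would carry no information.
\<close>

lemma iterate_derivative:
  obtains \<kappa> where "1 < \<kappa>"
    and "\<And>ws x. ws \<in> lists \<P> \<Longrightarrow> x \<in> cyl ws \<Longrightarrow>
      ((f ^^ length ws) has_real_derivative vector_derivative (f ^^ length ws) (at x within cyl ws))
        (at x within cyl ws) \<and>
      \<kappa> ^ length ws \<le> \<bar>vector_derivative (f ^^ length ws) (at x within cyl ws)\<bar>"
proof -
  obtain \<kappa> where \<kappa>: "1 < \<kappa>"
    and exp: "\<forall>P\<in>\<P>. \<forall>x\<in>P. \<kappa> \<le> \<bar>vector_derivative f (at x within P)\<bar>"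
    using expanding by auto
  have ex: "\<exists>D. ((f ^^ length ws) has_real_derivative D) (at x within cyl ws) \<and> \<kappa> ^ length ws \<le> \<bar>D\<bar>"
    if "ws \<in> lists \<P>" "x \<in> cyl ws" for ws x
    using that
  proof (induction ws arbitrary: x)
    case Nil
    have "((\<lambda>y. y) has_real_derivative 1) (at x within I)" by (rule DERIV_ident)
    then show ?case by (auto simp: id_def intro!: exI[of _ 1])
  next
    case (Cons P ws)
    then have P: "P \<in> \<P>" and x: "x \<in> P" "f x \<in> cyl ws" by (auto simp: cyl_Cons)
    obtain D where D: "((f ^^ length ws) has_real_derivative D) (at (f x) within cyl ws)"
      "\<kappa> ^ length ws \<le> \<bar>D\<bar>"
      using Cons.IH[OF x(2)] by auto
    let ?D1 = "vector_derivative f (at x within P)"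
    have sub: "cyl (P # ws) \<subseteq> P" "f ` cyl (P # ws) \<subseteq> cyl ws" by (auto simp: cyl_Cons[OF P])
    have "((f ^^ length ws) \<circ> f has_real_derivative D * ?D1) (at x within cyl (P # ws))"
      using has_field_derivative_subset[OF D(1) sub(2)]
        has_field_derivative_subset[OF element_has_derivative[OF P x(1)] sub(1)]
      by (rule DERIV_image_chain)
    moreover have "f ^^ length (P # ws) = (f ^^ length ws) \<circ> f"
      by (simp only: length_Cons funpow_Suc_right)
    moreover have "\<kappa> ^ length (P # ws) \<le> \<bar>D * ?D1\<bar>"
    proof -
      have "\<kappa> \<le> \<bar>?D1\<bar>" using exp P x(1) by blast
      then have "\<kappa> * \<kappa> ^ length ws \<le> \<bar>?D1\<bar> * \<bar>D\<bar>"
        using D(2) \<kappa> by (intro mult_mono) auto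
      then show ?thesis by (simp add: abs_mult mult.commute)
    qed
    ultimately show ?case by (intro exI[of _ "D * ?D1"]) (simp only: simp_thms)
  qed
  show ?thesis
  proof (rule that[OF \<kappa>])
    fix ws x assume ws: "ws \<in> lists \<P>" "x \<in> cyl ws"
    obtain D where D: "((f ^^ length ws) has_real_derivative D) (at x within cyl ws)"
      "\<kappa> ^ length ws \<le> \<bar>D\<bar>" using ex[OF ws] by auto
    have "x islimpt cyl ws"
    proof (rule connected_imp_perfect)
      show "connected (cyl ws)" using cyl_interval[OF ws(1)] by (rule is_interval_connected)
      show "cyl ws \<noteq> {y}" for y using cyl_infinite[OF ws(1)] by auto
    qed (rule ws(2))
    then have "vector_derivative (f ^^ length ws) (at x within cyl ws) = D"
      using D(1) by (intro vector_derivative_within)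
        (auto simp: trivial_limit_within has_real_derivative_iff_has_vector_derivative)
    then show "((f ^^ length ws) has_real_derivative
          vector_derivative (f ^^ length ws) (at x within cyl ws)) (at x within cyl ws) \<and>
        \<kappa> ^ length ws \<le> \<bar>vector_derivative (f ^^ length ws) (at x within cyl ws)\<bar>"
      using D by simp
  qed
qed

lemma iterate_mvt:
  assumes ws: "ws \<in> lists \<P>" and "x \<in> cyl ws" "y \<in> cyl ws"
    and der: "\<And>z. z \<in> cyl ws \<Longrightarrow> ((f ^^ length ws) has_real_derivative g z) (at z within cyl ws)"
  shows "\<exists>z\<in>cyl ws. \<bar>(f ^^ length ws) x - (f ^^ length ws) y\<bar> = \<bar>g z\<bar> * \<bar>x - y\<bar>"
proof -
  have *: "\<exists>z\<in>cyl ws. \<bar>(f ^^ length ws) x - (f ^^ length ws) y\<bar> = \<bar>g z\<bar> * \<bar>x - y\<bar>"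
    if xy: "x \<in> cyl ws" "y \<in> cyl ws" "x < y" for x y
  proof -
    have sub: "{x..y} \<subseteq> cyl ws"
    proof
      fix z assume "z \<in> {x..y}"
      then have "x \<le> z" "z \<le> y" by simp_all
      then show "z \<in> cyl ws" using mem_is_interval_1_I[OF cyl_interval[OF ws] xy(1,2)] by blast
    qed
    have "\<exists>z\<in>{x<..<y}. (f ^^ length ws) y - (f ^^ length ws) x = g z * (y - x)"
    proof (rule mvt_simple[OF xy(3)])
      fix z assume "x \<le> z" "z \<le> y"
      then have "z \<in> cyl ws" using sub by auto
      from has_field_derivative_subset[OF der[OF this] sub]
      show "((f ^^ length ws) has_derivative (*) (g z)) (at z within {x..y})"
        by (simp add: has_field_derivative_def)
    qed
    then obtain z where z: "z \<in> {x<..<y}" "(f ^^ length ws) y - (f ^^ length ws) x = g z * (y - x)"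
      by auto
    have "\<bar>(f ^^ length ws) x - (f ^^ length ws) y\<bar> = \<bar>g z\<bar> * \<bar>x - y\<bar>"
      using arg_cong[OF z(2), of abs] by (simp only: abs_mult abs_minus_commute)
    moreover have "z \<in> cyl ws" using z(1) sub by auto
    ultimately show ?thesis by blast
  qed
  consider "x < y" | "x = y" | "y < x" by linarith
  then show ?thesis
  proof cases
    case 1
    then show ?thesis by (rule *[OF assms(2,3)])
  next
    case 2
    then show ?thesis using assms(2) by auto
  next
    case 3
    then show ?thesis using *[OF assms(3,2)] by (simp only: abs_minus_commute)
  qed
qed

lemma iterate_expanding:
  obtains \<kappa> where "1 < \<kappa>"
    and "\<And>ws x y. ws \<in> lists \<P> \<Longrightarrow> x \<in> cyl ws \<Longrightarrow> y \<in> cyl ws \<Longrightarrow>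
      \<kappa> ^ length ws * \<bar>x - y\<bar> \<le> \<bar>(f ^^ length ws) x - (f ^^ length ws) y\<bar>"
proof -
  obtain \<kappa> where \<kappa>: "1 < \<kappa>" and der: "\<And>ws x. ws \<in> lists \<P> \<Longrightarrow> x \<in> cyl ws \<Longrightarrow>
      ((f ^^ length ws) has_real_derivative vector_derivative (f ^^ length ws) (at x within cyl ws))
        (at x within cyl ws) \<and>
      \<kappa> ^ length ws \<le> \<bar>vector_derivative (f ^^ length ws) (at x within cyl ws)\<bar>"
    using iterate_derivative by metis
  show ?thesis
  proof (rule that[OF \<kappa>])
    fix ws x y assume ws: "ws \<in> lists \<P>" "x \<in> cyl ws" "y \<in> cyl ws"
    obtain z where "z \<in> cyl ws" "\<bar>(f ^^ length ws) x - (f ^^ length ws) y\<bar> =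
        \<bar>vector_derivative (f ^^ length ws) (at z within cyl ws)\<bar> * \<bar>x - y\<bar>"
      using iterate_mvt[OF ws, of "\<lambda>z. vector_derivative (f ^^ length ws) (at z within cyl ws)"]
        der[OF ws(1)] by auto
    then show "\<kappa> ^ length ws * \<bar>x - y\<bar> \<le> \<bar>(f ^^ length ws) x - (f ^^ length ws) y\<bar>"
      using der[OF ws(1)] by (auto intro: mult_right_mono)
  qed
qed

text \<open>
  On a cylinder the slopes of the iterate differ by bounded factors only, so that it distorts
  distances as an affine map of slope \<open>\<Lambda>\<close> would, up to the factor \<open>K\<close>. It is essential that
  \<open>K\<close> does not depend on the word.
\<close>

lemma iterate_similar_to_affine:
  obtains K where "1 \<le> K"
    and "\<And>ws. ws \<in> lists \<P> \<Longrightarrow> \<exists>\<Lambda>>0. \<forall>x\<in>cyl ws. \<forall>y\<in>cyl ws.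
      \<Lambda> / K * \<bar>x - y\<bar> \<le> \<bar>(f ^^ length ws) x - (f ^^ length ws) y\<bar> \<and>
      \<bar>(f ^^ length ws) x - (f ^^ length ws) y\<bar> \<le> \<Lambda> * K * \<bar>x - y\<bar>"
proof -
  obtain \<kappa> where \<kappa>: "1 < \<kappa>" and der: "\<And>ws x. ws \<in> lists \<P> \<Longrightarrow> x \<in> cyl ws \<Longrightarrow>
      ((f ^^ length ws) has_real_derivative vector_derivative (f ^^ length ws) (at x within cyl ws))
        (at x within cyl ws) \<and>
      \<kappa> ^ length ws \<le> \<bar>vector_derivative (f ^^ length ws) (at x within cyl ws)\<bar>"
    using iterate_derivative by metis
  obtain K0 where K0: "\<And>n Q x y. Q \<in> cylinders I \<P> f n \<Longrightarrow> x \<in> Q \<Longrightarrow> y \<in> Q \<Longrightarrow>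
      \<bar>vector_derivative (f ^^ n) (at x within Q)\<bar> /
      \<bar>vector_derivative (f ^^ n) (at y within Q)\<bar> \<le> K0"
    using bounded_distortion by metis
  define K where "K = max K0 1"
  have K: "1 \<le> K" by (simp add: K_def)
  show ?thesis
  proof (rule that[OF K])
    fix ws assume ws: "ws \<in> lists \<P>"
    define n where "n = length ws"
    define g where "g z = vector_derivative (f ^^ n) (at z within cyl ws)" for z
    have gder: "((f ^^ n) has_real_derivative g z) (at z within cyl ws)" "1 \<le> \<bar>g z\<bar>"
      if "z \<in> cyl ws" for z
    proof -
      have "1 \<le> \<kappa> ^ n" using \<kappa> by simp
      then show "((f ^^ n) has_real_derivative g z) (at z within cyl ws)" "1 \<le> \<bar>g z\<bar>"
        using der[OF ws that] by (auto simp: g_def n_def)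
    qed
    have dist: "\<bar>g x\<bar> \<le> K * \<bar>g y\<bar>" if "x \<in> cyl ws" "y \<in> cyl ws" for x y
    proof -
      have "\<bar>g x\<bar> / \<bar>g y\<bar> \<le> K"
        using K0[OF cyl_in_cylinders[OF ws cyl_nonempty[OF ws]] that]
        by (simp add: g_def n_def K_def)
      moreover have "0 < \<bar>g y\<bar>" using gder(2)[OF that(2)] by linarith
      ultimately show ?thesis by (simp only: pos_divide_le_eq)
    qed
    obtain z0 where z0: "z0 \<in> cyl ws" using cyl_nonempty[OF ws] by auto
    \<comment> \<open>Any slope on the cylinder can serve as reference.\<close>
    show "\<exists>\<Lambda>>0. \<forall>x\<in>cyl ws. \<forall>y\<in>cyl ws.
      \<Lambda> / K * \<bar>x - y\<bar> \<le> \<bar>(f ^^ length ws) x - (f ^^ length ws) y\<bar> \<and>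
      \<bar>(f ^^ length ws) x - (f ^^ length ws) y\<bar> \<le> \<Lambda> * K * \<bar>x - y\<bar>"
    proof (intro exI[of _ "\<bar>g z0\<bar>"] conjI ballI)
      show "0 < \<bar>g z0\<bar>" using gder(2)[OF z0] by linarith
      fix x y assume xy: "x \<in> cyl ws" "y \<in> cyl ws"
      obtain z where z: "z \<in> cyl ws"
        "\<bar>(f ^^ length ws) x - (f ^^ length ws) y\<bar> = \<bar>g z\<bar> * \<bar>x - y\<bar>"
        using iterate_mvt[OF ws xy, of g] gder(1) by (auto simp: n_def)
      show "\<bar>g z0\<bar> / K * \<bar>x - y\<bar> \<le> \<bar>(f ^^ length ws) x - (f ^^ length ws) y\<bar>"
        unfolding z(2) using dist[OF z0 z(1)] K
        by (intro mult_right_mono) (auto simp: pos_divide_le_eq mult.commute)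
      show "\<bar>(f ^^ length ws) x - (f ^^ length ws) y\<bar> \<le> \<bar>g z0\<bar> * K * \<bar>x - y\<bar>"
        unfolding z(2) using dist[OF z(1) z0] K
        by (intro mult_right_mono) (auto simp: mult.commute)
    qed
  qed
qed

end

context gibbs_system
begin

sublocale prob_space \<mu>
  by (rule prob)

lemma space_UNIV [simp]: "space \<mu> = UNIV"
  using sets_eq_imp_space_eq[OF prob(2)] by simp

lemma sets_borel [simp]: "sets \<mu> = sets borel"
  by (rule prob(2))

lemma mass_Int_I:
  assumes "A \<in> sets borel"
  shows "measure \<mu> (A \<inter> I) = measure \<mu> A"
proof -
  have I: "I \<in> sets borel" using interval(1) by (rule real_interval_borel_measurable)
  have "measure \<mu> A = measure \<mu> (A \<inter> I) + measure \<mu> (A - I)"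
    using assms I finite_measure_Union[of "A \<inter> I" "A - I"] by (simp add: Int_Diff_Un Int_Diff_disjoint)
  moreover have "measure \<mu> (A - I) \<le> measure \<mu> (UNIV - I)"
    using assms I by (intro finite_measure_mono) auto
  moreover have "measure \<mu> (UNIV - I) = 0"
    using prob_compl[of I] I prob(3) by simp
  ultimately show ?thesis using measure_nonneg[of \<mu> "A - I"] by linarith
qed

section \<open>The map has at least two branches and a compact domain\<close>

lemma mass_iterate_preimage:
  assumes cont: "continuous_on I f" and A: "A \<in> sets borel"
  shows "{x \<in> I. (f ^^ n) x \<in> A} \<in> sets borel \<and>
    measure \<mu> {x \<in> I. (f ^^ n) x \<in> A} = measure \<mu> A"
proof (induction n)
  case 0
  have "I \<in> sets borel" using interval(1) by (rule real_interval_borel_measurable)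
  then show ?case using mass_Int_I[OF A] A
    by (auto simp: Collect_conj_eq Int_commute)
next
  case (Suc n)
  let ?B = "{x \<in> I. (f ^^ n) x \<in> A}"
  have eq: "{x \<in> I. (f ^^ Suc n) x \<in> A} = {x \<in> I. f x \<in> ?B}"
    using self_map by (auto simp: funpow_swap1)
  have I: "I \<in> sets borel" using interval(1) by (rule real_interval_borel_measurable)
  have "f -` ?B \<inter> space (restrict_space borel I) \<in> sets (restrict_space borel I)"
    using borel_measurable_continuous_on_restrict[OF cont] Suc by (intro measurable_sets) auto
  then have "f -` ?B \<inter> I \<in> sets borel"
    using I by (simp add: sets_restrict_space_iff space_restrict_space)
  moreover have "f -` ?B \<inter> I = {x \<in> I. f x \<in> ?B}" by auto
  ultimately show ?case unfolding eq using Suc invariant[of ?B] by simp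
qed

lemma ex_interval_mass_gt:
  assumes "t < 1"
  shows "\<exists>R. t < measure \<mu> {-R..R}"
proof -
  have "(\<lambda>n. measure \<mu> {- real n..real n}) \<longlonglongrightarrow> measure \<mu> (\<Union>n. {- real n..real n})"
    by (intro finite_Lim_measure_incseq) (auto simp: incseq_def)
  moreover have "(\<Union>n. {- real n..real n}) = UNIV"
  proof (intro equalityI subsetI UNIV_I)
    fix x :: real
    obtain n where "\<bar>x\<bar> \<le> real n" using real_arch_simple by blast
    then show "x \<in> (\<Union>n. {- real n..real n})" by (auto simp: abs_le_iff intro!: exI[of _ n])
  qed
  ultimately have "(\<lambda>n. measure \<mu> {- real n..real n}) \<longlonglongrightarrow> 1"
    using prob_space by simp
  then have "\<forall>\<^sub>F n in sequentially. t < measure \<mu> {- real n..real n}"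
    using assms by (rule order_tendstoD)
  then show ?thesis by (auto simp: eventually_sequentially)
qed

text \<open>
  If there were only one branch, \<open>f\<close> would expand distances on all of \<open>I\<close>. Then the preimages
  under \<open>f ^^ n\<close> of a bounded set that carries almost all of the mass would carry the same mass, while
  their diameters tend to \<open>0\<close>. But a set of almost full mass must meet any two given balls of
  positive mass, and so cannot have a diameter smaller than the distance between them.
\<close>

lemma two_branches: "\<exists>P\<in>\<P>. \<exists>P'\<in>\<P>. P \<noteq> P'"
proof (rule ccontr)
  assume neg: "\<not> (\<exists>P\<in>\<P>. \<exists>P'\<in>\<P>. P \<noteq> P')"
  have I_eq: "I = \<Union>\<P>" using partition(2) by (simp add: partition_on_def)
  moreover obtain P0 where "P0 \<in> \<P>"
    using I_eq infinite_imp_nonempty[OF infinite_I] by auto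
  ultimately have P: "I \<in> \<P>" using neg by (metis Sup_empty cSup_singleton insertI1 is_singletonI' is_singleton_def empty_iff)
  have words: "replicate n I \<in> lists \<P>" for n using P by auto
  have cyl_rep: "cyl (replicate n I) = I" for n
    using iterate_mem by (auto simp: cyl_def)
  obtain \<kappa> where \<kappa>: "1 < \<kappa>" and
    ex: "\<And>ws x y. ws \<in> lists \<P> \<Longrightarrow> x \<in> cyl ws \<Longrightarrow> y \<in> cyl ws \<Longrightarrow>
      \<kappa> ^ length ws * \<bar>x - y\<bar> \<le> \<bar>(f ^^ length ws) x - (f ^^ length ws) y\<bar>"
    using iterate_expanding by metis
  have ex': "\<kappa> ^ n * \<bar>x - y\<bar> \<le> \<bar>(f ^^ n) x - (f ^^ n) y\<bar>" if "x \<in> I" "y \<in> I" for n x y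
    using ex[OF words[of n], of x y] that cyl_rep[of n] by simp
  obtain u where u: "u \<in> I" using infinite_imp_nonempty[OF infinite_I] by blast
  have "infinite (I - {u})" using infinite_I by simp
  then obtain v where v: "v \<in> I" "v \<noteq> u" using infinite_imp_nonempty by blast
  define e where "e = \<bar>u - v\<bar> / 4"
  have e: "0 < e" using v by (simp add: e_def)
  define t where "t = min (measure \<mu> (ball u e)) (measure \<mu> (ball v e))"
  have "0 < measure \<mu> (ball w e)" if "w \<in> I" for w
  proof (rule full_support)
    have "w \<in> ball w e" using e by simp
    then show "ball w e \<inter> I \<noteq> {}" using that by blast
  qed simp
  then have t: "0 < t" using u v(1) by (simp add: t_def)
  obtain R where R: "1 - t < measure \<mu> {-R..R}" using ex_interval_mass_gt[of "1 - t"] t by auto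
  obtain n where n: "R / e < \<kappa> ^ n" using real_arch_pow[OF \<kappa>] by blast
  let ?A = "{x \<in> I. (f ^^ n) x \<in> {-R..R}}"
  have A: "?A \<in> sets borel" "measure \<mu> ?A = measure \<mu> {-R..R}"
    using mass_iterate_preimage[OF element_continuous[OF P], of "{-R..R}" n] by auto
  have meets: "\<exists>x\<in>?A. x \<in> ball w e" if "t \<le> measure \<mu> (ball w e)" for w
  proof (rule ccontr)
    assume "\<not> ?thesis"
    then have "measure \<mu> ?A \<le> measure \<mu> (UNIV - ball w e)"
      using A by (intro finite_measure_mono) auto
    also have "\<dots> = 1 - measure \<mu> (ball w e)" using prob_compl[of "ball w e"] by simp
    finally show False using that R A(2) by linarith
  qed
  obtain x where x: "x \<in> ?A" "x \<in> ball u e" using meets[of u] by (auto simp: t_def)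
  obtain y where y: "y \<in> ?A" "y \<in> ball v e" using meets[of v] by (auto simp: t_def)
  have "dist u v \<le> dist u x + dist x y + dist v y"
    by (metis add.commute add_left_mono dist_commute dist_triangle dist_triangle_le)
  then have "2 * e \<le> \<bar>x - y\<bar>" using x(2) y(2) unfolding e_def by (simp add: dist_real_def)
  then have "\<kappa> ^ n * (2 * e) \<le> \<kappa> ^ n * \<bar>x - y\<bar>" using \<kappa> by (intro mult_left_mono) auto
  also have "\<dots> \<le> \<bar>(f ^^ n) x - (f ^^ n) y\<bar>" using ex' x(1) y(1) by blast
  also have "\<dots> \<le> 2 * R" using x(1) y(1) by auto
  finally show False using n e by (simp add: pos_divide_less_eq)
qed

lemma branch_extension:
  assumes "P \<in> \<P>"
  obtains g where "continuous_on (closure P) g" "bij_betw g (closure P) I"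
proof -
  obtain g where g: "diffeomorphism_on (closure P) I g" using full_branches[OF assms] by blast
  then obtain g' where "\<And>x. x \<in> closure P \<Longrightarrow> (g has_real_derivative g' x) (at x within closure P)"
    by (auto simp: diffeomorphism_on_def C1_on_def)
  then have "continuous_on (closure P) g" by (rule DERIV_continuous_on)
  then show ?thesis using g that by (auto simp: diffeomorphism_on_def)
qed

lemma compact_I_if_bounded_branch:
  assumes "P \<in> \<P>" "bounded P"
  shows "compact I"
proof -
  obtain g where g: "continuous_on (closure P) g" "bij_betw g (closure P) I"
    using branch_extension[OF assms(1)] .
  have "compact (closure P)" using assms(2) by (simp add: compact_closure)
  then show ?thesis using compact_continuous_image[OF g(1)] g(2) by (simp add: bij_betw_def)
qed

text \<open>
  Otherwise all elements of \<open>\<P>\<close> are unbounded. As two disjoint intervals, both unbounded, exist, one of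
  them, \<open>P\<close>, reaches down to minus infinity, the other one up to infinity, and \<open>I\<close> is the whole line.
  An injective continuous map from \<open>closure P\<close> onto the line cannot exist: its value at the right endpoint
  of \<open>P\<close> would be taken once more, between a point with a smaller value and one with a larger value.
\<close>

lemma compact_I: "compact I"
proof (rule ccontr)
  assume "\<not> compact I"
  then have unbounded: "\<not> bounded P" if "P \<in> \<P>" for P using compact_I_if_bounded_branch that by blast
  have no: False if P: "P \<in> \<P>" "P' \<in> \<P>" "P \<noteq> P'" and p: "p \<in> P" "p' \<in> P'" "p < p'" for P P' p p'
  proof -
    have ub: "y \<le> p'" if "y \<in> P" for y
    proof (rule ccontr)
      assume "\<not> y \<le> p'"
      then have "p' \<in> P"
        using mem_is_interval_1_I[OF partition(3)[OF P(1)] p(1) that, of p'] p(3) by linarith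
      then show False using element_disjoint P p(2) by blast
    qed
    have lb: "p \<le> y" if "y \<in> P'" for y
    proof (rule ccontr)
      assume "\<not> p \<le> y"
      then have "p \<in> P'"
        using mem_is_interval_1_I[OF partition(3)[OF P(2)] that p(2), of p] p(3) by linarith
      then show False using element_disjoint P p(1) by blast
    qed
    have bdd: "bdd_above P" using ub by (auto simp: bdd_above_def)
    have below: "\<exists>y\<in>P. y < z" for z
    proof (rule ccontr)
      assume "\<not> ?thesis"
      then have "P \<subseteq> {z..p'}" using ub by (auto simp: not_less)
      then show False using unbounded[OF P(1)] bounded_subset[OF bounded_closed_interval] by blast
    qed
    have above: "\<exists>y\<in>P'. z < y" for z
    proof (rule ccontr)
      assume "\<not> ?thesis"
      then have "P' \<subseteq> {p..z}" using lb by (auto simp: not_less)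
      then show False using unbounded[OF P(2)] bounded_subset[OF bounded_closed_interval] by blast
    qed
    have I: "z \<in> I" for z
    proof -
      obtain a b where ab: "a \<in> P" "a < z" "b \<in> P'" "z < b" using below above by blast
      then have "a \<in> I" "b \<in> I" using element_subset P by blast+
      then show ?thesis using mem_is_interval_1_I[OF interval(1)] ab by (meson less_imp_le)
    qed
    obtain g where g: "continuous_on (closure P) g" "bij_betw g (closure P) I"
      using branch_extension[OF P(1)] .
    define a where "a = Sup P"
    have a: "a \<in> closure P" unfolding a_def using p(1) bdd by (intro closure_contains_Sup) auto
    have "P \<subseteq> {..a}" using bdd by (auto simp: a_def intro: cSup_upper)
    then have ca: "closure P \<subseteq> {..a}" by (intro closure_minimal) auto
    have onto: "\<exists>y\<in>closure P. g y = w" for w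
      using g(2) I[of w] by (auto simp: bij_betw_def)
    obtain y z where y: "y \<in> closure P" "g y = g a - 1" and z: "z \<in> closure P" "g z = g a + 1"
      using onto by metis
    have lt: "y < a" "z < a" using y z ca by (auto simp: order_less_le)
    have conv: "convex (closure P)" using partition(3)[OF P(1)] by (simp add: is_interval_convex_1 convex_closure)
    have seg: "closed_segment y z \<subseteq> closure P" using conv y(1) z(1) by (rule closed_segment_subset[OF _ _, rotated -1])
    have "connected (g ` closed_segment y z)"
      using continuous_on_subset[OF g(1) seg] by (intro connected_continuous_image) auto
    then have "is_interval (g ` closed_segment y z)" by (simp add: is_interval_connected_1)
    then have "g a \<in> g ` closed_segment y z"
    proof (rule mem_is_interval_1_I)
      show "g y \<in> g ` closed_segment y z" "g z \<in> g ` closed_segment y z" by auto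
    qed (use y z in auto)
    then obtain w where w: "w \<in> closed_segment y z" "g w = g a" by auto
    then have "w < a" using lt by (auto simp: closed_segment_eq_real_ivl split: if_splits)
    moreover have "w = a" using w seg a g(2) by (auto simp: bij_betw_def inj_on_def)
    ultimately show False by simp
  qed
  obtain P P' where P: "P \<in> \<P>" "P' \<in> \<P>" "P \<noteq> P'" using two_branches by blast
  obtain p p' where p: "p \<in> P" "p' \<in> P'"
    using infinite_imp_nonempty[OF element_infinite] P by blast
  have "p \<noteq> p'" using element_disjoint P p by blast
  then show False using no[OF P p] no[OF P(2,1) P(3)[symmetric] p(2,1)] by linarith
qed

lemma bounded_cyl: "bounded (cyl ws)"
  using compact_imp_bounded[OF compact_I] cyl_subset by (rule bounded_subset)

lemma diameter_cyl_pos: "ws \<in> lists \<P> \<Longrightarrow> 0 < diameter (cyl ws)"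
  using cyl_infinite bounded_cyl by (intro diameter_pos_of_infinite)

lemma cyl_borel: "ws \<in> lists \<P> \<Longrightarrow> cyl ws \<in> sets borel"
  using cyl_interval by (intro real_interval_borel_measurable)

section \<open>Quasi-multiplicativity of length and mass\<close>

text \<open>
  The iterate along \<open>us\<close> maps the cylinder of \<open>us\<close> onto \<open>I\<close> and that of \<open>us @ vs\<close> onto the
  cylinder of \<open>vs\<close>, up to finitely many points. It scales both by the same slope \<open>\<Lambda>\<close>, up to
  bounded factors; eliminating \<open>\<Lambda>\<close> from the two resulting pairs of inequalities gives the claim.
\<close>

lemma diameter_concat:
  obtains K where "1 \<le> K"
    and "\<And>us vs. us \<in> lists \<P> \<Longrightarrow> vs \<in> lists \<P> \<Longrightarrow>
      diameter (cyl (us @ vs)) \<le> K * (diameter (cyl us) * diameter (cyl vs)) \<and>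
      diameter (cyl us) * diameter (cyl vs) \<le> K * diameter (cyl (us @ vs))"
proof -
  obtain K0 where K0: "1 \<le> K0" and affine: "\<And>ws. ws \<in> lists \<P> \<Longrightarrow> \<exists>\<Lambda>>0. \<forall>x\<in>cyl ws. \<forall>y\<in>cyl ws.
      \<Lambda> / K0 * \<bar>x - y\<bar> \<le> \<bar>(f ^^ length ws) x - (f ^^ length ws) y\<bar> \<and>
      \<bar>(f ^^ length ws) x - (f ^^ length ws) y\<bar> \<le> \<Lambda> * K0 * \<bar>x - y\<bar>"
    using iterate_similar_to_affine by metis
  define L where "L = diameter I"
  have L: "0 < L" using diameter_cyl_pos[of "[]"] by (simp add: L_def)
  define K where "K = Max {1, K0\<^sup>2 / L, K0\<^sup>2 * L}"
  have K: "1 \<le> K" "K0\<^sup>2 / L \<le> K" "K0\<^sup>2 * L \<le> K" by (auto simp: K_def)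
  show ?thesis
  proof (rule that[OF K(1)])
    fix us vs assume us: "us \<in> lists \<P>" and vs: "vs \<in> lists \<P>"
    define n where "n = length us"
    define a b c where "a = diameter (cyl us)" and "b = diameter (cyl vs)"
      and "c = diameter (cyl (us @ vs))"
    have pos: "0 < a" "0 < b" "0 < c"
      using us vs diameter_cyl_pos[of us] diameter_cyl_pos[of vs] diameter_cyl_pos[of "us @ vs"]
      by (auto simp: a_def b_def c_def)
    obtain \<Lambda> where \<Lambda>: "0 < \<Lambda>" and aff: "\<And>x y. x \<in> cyl us \<Longrightarrow> y \<in> cyl us \<Longrightarrow>
        \<Lambda> / K0 * \<bar>x - y\<bar> \<le> \<bar>(f ^^ n) x - (f ^^ n) y\<bar> \<and>
        \<bar>(f ^^ n) x - (f ^^ n) y\<bar> \<le> \<Lambda> * K0 * \<bar>x - y\<bar>"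
      using affine[OF us] unfolding n_def by blast
    have scale: "\<Lambda> / K0 * diameter W \<le> diameter ((f ^^ n) ` W) \<and>
        diameter ((f ^^ n) ` W) \<le> \<Lambda> * K0 * diameter W"
      if W: "W \<subseteq> cyl us" "W \<noteq> {}" for W
    proof
      have bW: "bounded W" using W(1) bounded_cyl by (rule bounded_subset[rotated])
      have "(f ^^ n) ` W \<subseteq> I" using W(1) cyl_subset iterate_mem by blast
      then have bf: "bounded ((f ^^ n) ` W)"
        using compact_imp_bounded[OF compact_I] by (rule bounded_subset[rotated])
      have "diameter W \<le> K0 / \<Lambda> * diameter ((f ^^ n) ` W)"
      proof (rule diameter_le)
        fix x y assume xy: "x \<in> W" "y \<in> W"
        have "\<Lambda> / K0 * \<bar>x - y\<bar> \<le> \<bar>(f ^^ n) x - (f ^^ n) y\<bar>" using aff xy W(1) by blast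
        also have "\<dots> \<le> diameter ((f ^^ n) ` W)"
          using diameter_bounded_bound[OF bf] xy by (simp add: dist_real_def)
        finally show "norm (x - y) \<le> K0 / \<Lambda> * diameter ((f ^^ n) ` W)"
          using \<Lambda> K0 by (simp add: field_simps)
      qed (use W in simp)
      then show "\<Lambda> / K0 * diameter W \<le> diameter ((f ^^ n) ` W)"
        using \<Lambda> K0 by (simp add: field_simps)
      show "diameter ((f ^^ n) ` W) \<le> \<Lambda> * K0 * diameter W"
      proof (rule diameter_le)
        fix x' y' assume "x' \<in> (f ^^ n) ` W" "y' \<in> (f ^^ n) ` W"
        then obtain x y where xy: "x \<in> W" "y \<in> W" "x' = (f ^^ n) x" "y' = (f ^^ n) y" by auto
        then have "\<bar>x' - y'\<bar> \<le> \<Lambda> * K0 * \<bar>x - y\<bar>" using aff W(1) by blast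
        also have "\<dots> \<le> \<Lambda> * K0 * diameter W"
          using diameter_bounded_bound[OF bW xy(1,2)] \<Lambda> K0
          by (intro mult_left_mono) (auto simp: dist_real_def)
        finally show "norm (x' - y') \<le> \<Lambda> * K0 * diameter W" by simp
      qed (use W in simp)
    qed
    have fin: "finite (I - (f ^^ n) ` cyl us)"
      unfolding n_def using us by (rule iterate_image_cofinite)
    have imI: "(f ^^ n) ` cyl us \<subseteq> I" using cyl_subset iterate_mem by blast
    have "diameter ((f ^^ n) ` cyl us) = L" unfolding L_def
      using imI by (intro diameter_interval_minus_finite[OF compact_imp_bounded[OF compact_I]
        interval(1) fin]) auto
    then have a: "\<Lambda> / K0 * a \<le> L" "L \<le> \<Lambda> * K0 * a"
      using scale[of "cyl us"] cyl_nonempty[OF us] by (auto simp: a_def)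
    have "(f ^^ n) ` cyl (us @ vs) = (f ^^ n) ` cyl us \<inter> cyl vs"
      by (auto simp: cyl_append n_def)
    then have "diameter ((f ^^ n) ` cyl (us @ vs)) = b" unfolding b_def
      using cyl_subset[of vs]
      by (intro diameter_interval_minus_finite[OF bounded_cyl cyl_interval[OF vs] fin]) auto
    then have c: "\<Lambda> / K0 * c \<le> b" "b \<le> \<Lambda> * K0 * c"
      using scale[of "cyl (us @ vs)"] cyl_nonempty[of "us @ vs"] us vs cyl_append_subset
      by (auto simp: c_def)
    have "L * c \<le> \<Lambda> * K0 * a * c" using a(2) pos by (intro mult_right_mono) auto
    also have "\<dots> = K0\<^sup>2 * a * (\<Lambda> / K0 * c)" using K0 by (simp add: power2_eq_square)
    also have "\<dots> \<le> K0\<^sup>2 * a * b" using c(1) pos by (intro mult_left_mono) auto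
    finally have "c \<le> K0\<^sup>2 / L * (a * b)" using L by (simp add: field_simps)
    also have "\<dots> \<le> K * (a * b)" using K(2) pos by (intro mult_right_mono) auto
    finally have 1: "c \<le> K * (a * b)" .
    have "a * b \<le> a * (\<Lambda> * K0 * c)" using c(2) pos by (intro mult_left_mono) auto
    also have "\<dots> = (\<Lambda> / K0 * a) * (K0\<^sup>2 * c)" using K0 by (simp add: power2_eq_square)
    also have "\<dots> \<le> L * (K0\<^sup>2 * c)" using a(1) pos by (intro mult_right_mono) auto
    also have "\<dots> = K0\<^sup>2 * L * c" by simp
    also have "\<dots> \<le> K * c" using K(3) pos by (intro mult_right_mono) auto
    finally have 2: "a * b \<le> K * c" .
    show "diameter (cyl (us @ vs)) \<le> K * (diameter (cyl us) * diameter (cyl vs)) \<and>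
      diameter (cyl us) * diameter (cyl vs) \<le> K * diameter (cyl (us @ vs))"
      using 1 2 by (simp add: a_def b_def c_def)
  qed
qed

lemma birkhoff_sum_add:
  "birkhoff_sum f (m + n) \<phi> x = birkhoff_sum f m \<phi> x + birkhoff_sum f n \<phi> ((f ^^ m) x)"
  by (induction n) (simp_all add: birkhoff_sum_def funpow_add add.commute[of m])

text \<open>
  Birkhoff sums are additive along orbits, so that the exponentials to which the Gibbs property compares
  the masses are multiplicative.
\<close>

lemma mass_concat:
  obtains K where "1 \<le> K"
    and "\<And>us vs. us \<in> lists \<P> \<Longrightarrow> vs \<in> lists \<P> \<Longrightarrow>
      measure \<mu> (cyl (us @ vs)) \<le> K * (measure \<mu> (cyl us) * measure \<mu> (cyl vs)) \<and>
      measure \<mu> (cyl us) * measure \<mu> (cyl vs) \<le> K * measure \<mu> (cyl (us @ vs))"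
    and "\<And>ws. ws \<in> lists \<P> \<Longrightarrow> 0 < measure \<mu> (cyl ws)"
proof -
  obtain C where C: "0 < C" and gibbs': "\<And>n Q x. Q \<in> cylinders I \<P> f n \<Longrightarrow> x \<in> Q \<Longrightarrow>
      1 / C \<le> measure \<mu> Q / exp (birkhoff_sum f n \<phi> x) \<and>
      measure \<mu> Q / exp (birkhoff_sum f n \<phi> x) \<le> C"
    using gibbs by blast
  have G: "exp (birkhoff_sum f (length ws) \<phi> x) \<le> C * measure \<mu> (cyl ws)"
      "measure \<mu> (cyl ws) \<le> C * exp (birkhoff_sum f (length ws) \<phi> x)"
    if "ws \<in> lists \<P>" "x \<in> cyl ws" for ws x
    using gibbs'[OF cyl_in_cylinders[OF that(1) cyl_nonempty[OF that(1)]] that(2)] C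
    by (simp_all add: field_simps)
  define K where "K = max 1 (C ^ 3)"
  have K: "1 \<le> K" "C ^ 3 \<le> K" by (auto simp: K_def)
  show ?thesis
  proof (rule that[OF K(1)])
    show pos: "0 < measure \<mu> (cyl ws)" if ws: "ws \<in> lists \<P>" for ws
    proof -
      obtain x where "x \<in> cyl ws" using cyl_nonempty[OF ws] by blast
      then have "0 < C * measure \<mu> (cyl ws)" using G(1)[OF ws] by (meson exp_gt_zero less_le_trans)
      then show ?thesis using C by (simp add: zero_less_mult_iff)
    qed
    fix us vs assume us: "us \<in> lists \<P>" and vs: "vs \<in> lists \<P>"
    then have uv: "us @ vs \<in> lists \<P>" by simp
    obtain x where x: "x \<in> cyl (us @ vs)" using cyl_nonempty[OF uv] by blast
    then have xu: "x \<in> cyl us" and xv: "(f ^^ length us) x \<in> cyl vs" by (auto simp: cyl_append)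
    define p q where "p = exp (birkhoff_sum f (length us) \<phi> x)"
      and "q = exp (birkhoff_sum f (length vs) \<phi> ((f ^^ length us) x))"
    have pq: "0 < p" "0 < q" by (auto simp: p_def q_def)
    define a b c where "a = measure \<mu> (cyl us)" and "b = measure \<mu> (cyl vs)"
      and "c = measure \<mu> (cyl (us @ vs))"
    have nn: "0 < a" "0 < b" "0 < c" using pos us vs uv by (auto simp: a_def b_def c_def)
    have e: "exp (birkhoff_sum f (length (us @ vs)) \<phi> x) = p * q"
      by (simp add: birkhoff_sum_add exp_add p_def q_def)
    have a: "p \<le> C * a" "a \<le> C * p" using G[OF us xu] by (auto simp: a_def p_def)
    have b: "q \<le> C * b" "b \<le> C * q" using G[OF vs xv] by (auto simp: b_def q_def)
    have c: "p * q \<le> C * c" "c \<le> C * (p * q)" using G[OF uv x] unfolding e c_def by auto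
    have "p * q \<le> (C * a) * (C * b)" using a b pq C nn by (intro mult_mono) auto
    then have "C * (p * q) \<le> C * ((C * a) * (C * b))" using C by (intro mult_left_mono) auto
    then have "c \<le> C ^ 3 * (a * b)" using c(2) by (simp add: power3_eq_cube mult_ac)
    also have "\<dots> \<le> K * (a * b)" using K(2) nn by (intro mult_right_mono) auto
    finally have 1: "c \<le> K * (a * b)" .
    have "a * b \<le> (C * p) * (C * q)" using a b pq C nn by (intro mult_mono) auto
    also have "\<dots> = C\<^sup>2 * (p * q)" by (simp add: power2_eq_square)
    also have "\<dots> \<le> C\<^sup>2 * (C * c)" using c(1) by (intro mult_left_mono) auto
    also have "\<dots> = C ^ 3 * c" by (simp add: power2_eq_square power3_eq_cube)
    also have "\<dots> \<le> K * c" using K(2) nn by (intro mult_right_mono) auto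
    finally have 2: "a * b \<le> K * c" .
    show "measure \<mu> (cyl (us @ vs)) \<le> K * (measure \<mu> (cyl us) * measure \<mu> (cyl vs)) \<and>
      measure \<mu> (cyl us) * measure \<mu> (cyl vs) \<le> K * measure \<mu> (cyl (us @ vs))"
      using 1 2 by (simp add: a_def b_def c_def)
  qed
qed

section \<open>Sizes of children and stopping cylinders\<close>

text \<open>
  Passing from a word to one letter more shrinks the length by a bounded factor at most. The mass shrinks
  by a definite factor, since the children of a cylinder are disjoint, there are at least two of them,
  and each carries a definite proportion of the mass.
\<close>

lemma child_bounds:
  obtains \<theta> where "0 < \<theta>" "\<theta> < 1"
    and "\<And>ws P. ws \<in> lists \<P> \<Longrightarrow> P \<in> \<P> \<Longrightarrow> \<theta> * diameter (cyl ws) \<le> diameter (cyl (ws @ [P]))"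
    and "\<And>ws P. ws \<in> lists \<P> \<Longrightarrow> P \<in> \<P> \<Longrightarrow>
      measure \<mu> (cyl (ws @ [P])) \<le> (1 - \<theta>) * measure \<mu> (cyl ws)"
proof -
  obtain K1 where K1: "1 \<le> K1" and d: "\<And>us vs. us \<in> lists \<P> \<Longrightarrow> vs \<in> lists \<P> \<Longrightarrow>
      diameter (cyl us) * diameter (cyl vs) \<le> K1 * diameter (cyl (us @ vs))"
    using diameter_concat by metis
  obtain K2 where K2: "1 \<le> K2" and m: "\<And>us vs. us \<in> lists \<P> \<Longrightarrow> vs \<in> lists \<P> \<Longrightarrow>
      measure \<mu> (cyl us) * measure \<mu> (cyl vs) \<le> K2 * measure \<mu> (cyl (us @ vs))"
    and mpos: "\<And>ws. ws \<in> lists \<P> \<Longrightarrow> 0 < measure \<mu> (cyl ws)"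
    using mass_concat by metis
  define S where "S = insert (1 / 2) ((\<lambda>P. diameter (cyl [P]) / K1) ` \<P> \<union> (\<lambda>P. measure \<mu> (cyl [P]) / K2) ` \<P>)"
  define \<theta> where "\<theta> = Min S"
  have fin: "finite S" using partition(1) by (simp add: S_def)
  have "0 < s" if "s \<in> S" for s
    using that diameter_cyl_pos mpos K1 K2 by (auto simp: S_def)
  then have "0 < \<theta>" unfolding \<theta>_def using fin by (subst Min_gr_iff) (auto simp: S_def)
  have le: "\<theta> \<le> s" if "s \<in> S" for s using fin that by (simp add: \<theta>_def)
  have "\<theta> < 1" using le[of "1 / 2"] by (simp add: S_def)
  have mchild: "\<theta> * measure \<mu> (cyl ws) \<le> measure \<mu> (cyl (ws @ [P]))"
    if ws: "ws \<in> lists \<P>" and P: "P \<in> \<P>" for ws P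
  proof -
    have "\<theta> * measure \<mu> (cyl ws) \<le> measure \<mu> (cyl [P]) / K2 * measure \<mu> (cyl ws)"
      using P by (intro mult_right_mono le) (auto simp: S_def)
    also have "\<dots> = measure \<mu> (cyl ws) * measure \<mu> (cyl [P]) / K2" by simp
    also have "\<dots> \<le> measure \<mu> (cyl (ws @ [P]))"
      using m[OF ws, of "[P]"] P K2 by (simp add: divide_le_eq mult.commute)
    finally show ?thesis .
  qed
  show ?thesis
  proof (rule that[OF \<open>0 < \<theta>\<close> \<open>\<theta> < 1\<close>])
    fix ws P assume ws: "ws \<in> lists \<P>" and P: "P \<in> \<P>"
    have "\<theta> * diameter (cyl ws) \<le> diameter (cyl [P]) / K1 * diameter (cyl ws)"
      using P diameter_cyl_pos[OF ws] by (intro mult_right_mono le) (auto simp: S_def)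
    also have "\<dots> = diameter (cyl ws) * diameter (cyl [P]) / K1" by simp
    also have "\<dots> \<le> diameter (cyl (ws @ [P]))"
      using d[OF ws, of "[P]"] P K1 by (simp add: divide_le_eq mult.commute)
    finally show "\<theta> * diameter (cyl ws) \<le> diameter (cyl (ws @ [P]))" .
    obtain P' where P': "P' \<in> \<P>" "P' \<noteq> P" using two_branches by metis
    have disj: "cyl (ws @ [P]) \<inter> cyl (ws @ [P']) = {}"
    proof (rule ccontr)
      assume "\<not> ?thesis"
      then obtain x where "(f ^^ length ws) x \<in> cyl [P]" "(f ^^ length ws) x \<in> cyl [P']"
        by (auto simp: cyl_append)
      then show False using element_disjoint[OF P P'(1)] P'(2) by (simp add: cyl_single P P'(1))
    qed
    have borel: "cyl (ws @ [P]) \<in> sets \<mu>" "cyl (ws @ [P']) \<in> sets \<mu>" "cyl ws \<in> sets \<mu>"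
      using cyl_borel ws P P'(1) by simp_all
    have "measure \<mu> (cyl (ws @ [P])) + measure \<mu> (cyl (ws @ [P'])) =
        measure \<mu> (cyl (ws @ [P]) \<union> cyl (ws @ [P']))"
      using finite_measure_Union[OF borel(1,2) disj] by simp
    also have "\<dots> \<le> measure \<mu> (cyl ws)"
      using cyl_append_subset[of ws] borel(3) by (intro finite_measure_mono) auto
    finally show "measure \<mu> (cyl (ws @ [P])) \<le> (1 - \<theta>) * measure \<mu> (cyl ws)"
      using mchild[OF ws P'(1)] by (simp add: algebra_simps)
  qed
qed

lemma ex_small_cylinder:
  assumes "0 < r" "x \<in> I"
  shows "\<exists>n. diameter (cyl (itinerary x n)) \<le> r"
proof -
  obtain \<kappa> where \<kappa>: "1 < \<kappa>" and
    ex: "\<And>ws x y. ws \<in> lists \<P> \<Longrightarrow> x \<in> cyl ws \<Longrightarrow> y \<in> cyl ws \<Longrightarrow>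
      \<kappa> ^ length ws * \<bar>x - y\<bar> \<le> \<bar>(f ^^ length ws) x - (f ^^ length ws) y\<bar>"
    using iterate_expanding by metis
  obtain n where n: "diameter I / r < \<kappa> ^ n" using real_arch_pow[OF \<kappa>] by blast
  have "diameter (cyl (itinerary x n)) \<le> r"
  proof (rule diameter_le)
    fix y z assume yz: "y \<in> cyl (itinerary x n)" "z \<in> cyl (itinerary x n)"
    then have I: "y \<in> I" "z \<in> I" using cyl_subset by blast+
    have "\<kappa> ^ n * \<bar>y - z\<bar> \<le> \<bar>(f ^^ n) y - (f ^^ n) z\<bar>"
      using ex[OF itinerary_in_lists[OF assms(2)] yz] by simp
    also have "\<dots> \<le> diameter I"
      using diameter_bounded_bound[OF compact_imp_bounded[OF compact_I] iterate_mem[OF I(1)] iterate_mem[OF I(2)]]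
      by (simp add: dist_real_def)
    also have "\<dots> \<le> \<kappa> ^ n * r" using n assms(1) by (simp add: pos_divide_less_eq)
    finally show "norm (y - z) \<le> r" using \<kappa> by simp
  qed (use assms(1) in simp)
  then show ?thesis ..
qed

text \<open>
  The first cylinder around \<open>x\<close> of length at most \<open>r\<close>. For fixed \<open>r\<close> these stopping cylinders
  partition \<open>I\<close> into pieces of length comparable to \<open>r\<close>.
\<close>

definition stop_cyl :: "real \<Rightarrow> real \<Rightarrow> real set" where
  "stop_cyl r x = cyl (itinerary x (LEAST n. diameter (cyl (itinerary x n)) \<le> r))"

lemma stop_cyl_word: "x \<in> I \<Longrightarrow> \<exists>ws\<in>lists \<P>. stop_cyl r x = cyl ws"
  using itinerary_in_lists by (auto simp: stop_cyl_def)

lemma mem_stop_cyl: "x \<in> I \<Longrightarrow> x \<in> stop_cyl r x"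
  using mem_cyl_itinerary by (simp add: stop_cyl_def)

lemma diameter_stop_cyl_le: "0 < r \<Longrightarrow> x \<in> I \<Longrightarrow> diameter (stop_cyl r x) \<le> r"
  unfolding stop_cyl_def by (rule LeastI_ex) (rule ex_small_cylinder)

lemma diameter_stop_cyl_ge:
  obtains c where "0 < c" "\<And>r x. 0 < r \<Longrightarrow> r \<le> 1 \<Longrightarrow> x \<in> I \<Longrightarrow> c * r \<le> diameter (stop_cyl r x)"
proof -
  obtain \<theta> where \<theta>: "0 < \<theta>" and child: "\<And>ws P. ws \<in> lists \<P> \<Longrightarrow> P \<in> \<P> \<Longrightarrow>
      \<theta> * diameter (cyl ws) \<le> diameter (cyl (ws @ [P]))"
    using child_bounds by metis
  have L: "0 < diameter I" using diameter_cyl_pos[of "[]"] by simp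
  define c where "c = min \<theta> (diameter I)"
  have c: "0 < c" "c \<le> \<theta>" "c \<le> diameter I" using \<theta> L by (auto simp: c_def)
  show ?thesis
  proof (rule that[OF c(1)])
    fix r x assume r: "0 < r" "r \<le> (1::real)" and x: "x \<in> I"
    define n where "n = (LEAST n. diameter (cyl (itinerary x n)) \<le> r)"
    show "c * r \<le> diameter (stop_cyl r x)"
    proof (cases n)
      case 0
      then have "stop_cyl r x = cyl (itinerary x 0)" by (simp only: stop_cyl_def n_def)
      then have "stop_cyl r x = I" by (simp add: itinerary_def)
      moreover have "c * r \<le> diameter I * 1" using r c L by (intro mult_mono) auto
      ultimately show ?thesis by simp
    next
      case (Suc k)
      then have "\<not> diameter (cyl (itinerary x k)) \<le> r"
        using not_less_Least[of k "\<lambda>n. diameter (cyl (itinerary x n)) \<le> r"] by (simp add: n_def[symmetric])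
      then have "c * r \<le> \<theta> * diameter (cyl (itinerary x k))"
        using r c by (intro mult_mono) auto
      also have "\<dots> \<le> diameter (cyl (itinerary x n))"
        using itinerary_Suc[OF x, of k] child[OF itinerary_in_lists[OF x, of k]] Suc by force
      finally show ?thesis by (simp add: stop_cyl_def n_def)
    qed
  qed
qed

text \<open>
  A point of the stopping cylinder of \<open>x\<close> has the same itinerary as \<open>x\<close> up to the stopping time,
  hence the same stopping time.
\<close>

lemma stop_cyl_eq:
  assumes r: "0 < r" and x: "x \<in> I" and z: "z \<in> stop_cyl r x"
  shows "stop_cyl r z = stop_cyl r x"
proof -
  define n where "n = (LEAST n. diameter (cyl (itinerary x n)) \<le> r)"
  have zn: "itinerary z n = itinerary x n"
    using itinerary_eqI[OF itinerary_in_lists[OF x], of z n] z by (simp add: stop_cyl_def n_def)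
  have same: "itinerary z k = itinerary x k" if "k \<le> n" for k
    using itinerary_prefix[OF that, of z] itinerary_prefix[OF that, of x] zn by simp
  have "(LEAST n. diameter (cyl (itinerary z n)) \<le> r) = n"
  proof (rule Least_equality)
    have "diameter (cyl (itinerary x n)) \<le> r"
      unfolding n_def using ex_small_cylinder[OF r x] by (rule LeastI_ex)
    then show "diameter (cyl (itinerary z n)) \<le> r" by (simp add: zn)
    show "n \<le> k" if k: "diameter (cyl (itinerary z k)) \<le> r" for k
    proof (rule ccontr)
      assume neg: "\<not> n \<le> k"
      then have "diameter (cyl (itinerary x k)) \<le> r" using k same[of k] by simp
      then have "n \<le> k" unfolding n_def by (rule Least_le)
      then show False using neg by simp
    qed
  qed
  then have "stop_cyl r z = cyl (itinerary z n)" by (simp only: stop_cyl_def)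
  also have "\<dots> = cyl (itinerary x n)" by (simp only: zn)
  also have "\<dots> = stop_cyl r x" by (simp only: stop_cyl_def n_def)
  finally show ?thesis .
qed

section \<open>From cylinders to balls\<close>

text \<open>
  The stopping cylinders of the points of the ball cover it up to a null set. They are disjoint, of
  length comparable to \<open>r\<close> and close to \<open>x\<close>; therefore their number is bounded.
\<close>

lemma ball_mass_upper:
  assumes a: "0 \<le> a" and A: "0 \<le> A"
    and cyl: "\<And>ws. ws \<in> lists \<P> \<Longrightarrow> measure \<mu> (cyl ws) \<le> A * diameter (cyl ws) powr a"
  obtains B where "0 < B" "\<And>x r. 0 < r \<Longrightarrow> r \<le> 1 \<Longrightarrow> measure \<mu> (ball x r) \<le> B * r powr a"
proof -
  obtain c where c: "0 < c" and
    ge: "\<And>r x. 0 < r \<Longrightarrow> r \<le> 1 \<Longrightarrow> x \<in> I \<Longrightarrow> c * r \<le> diameter (stop_cyl r x)"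
    using diameter_stop_cyl_ge by metis
  define B where "B = 4 / c * A + 1"
  have B: "0 < B" using c A by (auto simp: B_def intro: add_nonneg_pos)
  show ?thesis
  proof (rule that[OF B])
    fix x r :: real assume r: "0 < r" "r \<le> 1"
    define \<Q> where "\<Q> = stop_cyl r ` (I \<inter> ball x r)"
    have disj: "disjoint \<Q>"
    proof (rule disjointI)
      fix Q Q' assume "Q \<in> \<Q>" "Q' \<in> \<Q>" "Q \<noteq> Q'"
      then obtain y y' where y: "y \<in> I" "y' \<in> I" "Q = stop_cyl r y" "Q' = stop_cyl r y'" "Q \<noteq> Q'"
        by (auto simp: \<Q>_def)
      show "Q \<inter> Q' = {}"
      proof (rule ccontr)
        assume "Q \<inter> Q' \<noteq> {}"
        then obtain z where "z \<in> stop_cyl r y" "z \<in> stop_cyl r y'" using y by auto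
        then show False using stop_cyl_eq[OF r(1)] y by metis
      qed
    qed
    have Q: "is_interval Q \<and> Q \<subseteq> ball x (2 * r) \<and> c * r \<le> diameter Q" if Q: "Q \<in> \<Q>" for Q
    proof -
      obtain y where y: "y \<in> I" "y \<in> ball x r" "Q = stop_cyl r y" using Q by (auto simp: \<Q>_def)
      obtain ws where ws: "ws \<in> lists \<P>" "Q = cyl ws" using stop_cyl_word y by blast
      have "z \<in> ball x (2 * r)" if "z \<in> Q" for z
      proof -
        have "dist y z \<le> diameter Q"
          unfolding ws(2) using that mem_stop_cyl[OF y(1), of r] ws y
          by (intro diameter_bounded_bound bounded_cyl) auto
        also have "\<dots> \<le> r" using diameter_stop_cyl_le[OF r(1) y(1)] y by simp
        finally show ?thesis using y(2) dist_triangle[of x z y] by simp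
      qed
      then show ?thesis using cyl_interval[OF ws(1)] ws(2) ge[OF r y(1)] y(3) by auto
    qed
    have card: "finite \<Q>" "real (card \<Q>) \<le> 2 * (2 * r) / (c * r)"
      using card_disjoint_long_intervals[OF disj Q] c r by auto
    have mass: "measure \<mu> Q \<le> A * r powr a" and Qb: "Q \<in> sets borel" if Q: "Q \<in> \<Q>" for Q
    proof -
      obtain y where y: "y \<in> I" "Q = stop_cyl r y" using Q by (auto simp: \<Q>_def)
      obtain ws where ws: "ws \<in> lists \<P>" "Q = cyl ws" using stop_cyl_word y by blast
      have "diameter (cyl ws) \<le> r" using diameter_stop_cyl_le[OF r(1) y(1)] y ws by simp
      then have "diameter (cyl ws) powr a \<le> r powr a"
        using diameter_cyl_pos[OF ws(1)] a by (intro powr_mono2) auto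
      then show "measure \<mu> Q \<le> A * r powr a"
        using cyl[OF ws(1)] A mult_left_mono ws(2) by fastforce
      show "Q \<in> sets borel" using cyl_borel ws by simp
    qed
    have "measure \<mu> (ball x r) = measure \<mu> (ball x r \<inter> I)" using mass_Int_I by simp
    also have "\<dots> \<le> measure \<mu> (\<Union>Q\<in>\<Q>. Q)"
    proof (rule finite_measure_mono)
      show "ball x r \<inter> I \<subseteq> (\<Union>Q\<in>\<Q>. Q)" using mem_stop_cyl by (auto simp: \<Q>_def)
      show "(\<Union>Q\<in>\<Q>. Q) \<in> sets \<mu>" using card(1) Qb by (intro sets.finite_UN) auto
    qed
    also have "\<dots> \<le> (\<Sum>Q\<in>\<Q>. measure \<mu> Q)"
      using card(1) Qb by (intro finite_measure_subadditive_finite) auto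
    also have "\<dots> \<le> real (card \<Q>) * (A * r powr a)"
      using sum_mono[OF mass, of \<Q>] by simp
    also have "\<dots> \<le> 4 / c * (A * r powr a)"
      using card(2) r c A by (intro mult_right_mono) (auto simp: field_simps)
    also have "\<dots> \<le> B * r powr a" by (simp add: B_def algebra_simps)
    finally show "measure \<mu> (ball x r) \<le> B * r powr a" .
  qed
qed

text \<open>
  The stopping cylinder of \<open>x\<close> of size \<open>r / 2\<close> is contained in the ball.
\<close>

lemma ball_mass_lower:
  assumes a: "0 \<le> a" and A: "0 < A"
    and cyl: "\<And>ws. ws \<in> lists \<P> \<Longrightarrow> A * diameter (cyl ws) powr a \<le> measure \<mu> (cyl ws)"
  obtains B where "0 < B"
    "\<And>x r. x \<in> I \<Longrightarrow> 0 < r \<Longrightarrow> r \<le> 1 \<Longrightarrow> B * r powr a \<le> measure \<mu> (ball x r)"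
proof -
  obtain c where c: "0 < c" and
    ge: "\<And>r x. 0 < r \<Longrightarrow> r \<le> 1 \<Longrightarrow> x \<in> I \<Longrightarrow> c * r \<le> diameter (stop_cyl r x)"
    using diameter_stop_cyl_ge by metis
  define B where "B = A * (c / 2) powr a"
  have B: "0 < B" using c A by (simp add: B_def)
  show ?thesis
  proof (rule that[OF B])
    fix x r :: real assume x: "x \<in> I" and r: "0 < r" "r \<le> 1"
    obtain ws where ws: "ws \<in> lists \<P>" "stop_cyl (r / 2) x = cyl ws" using stop_cyl_word x by blast
    have "c / 2 * r \<le> diameter (cyl ws)" using ge[of "r / 2" x] r x ws by simp
    then have "(c / 2 * r) powr a \<le> diameter (cyl ws) powr a"
      using a c r by (intro powr_mono2) auto
    moreover have "(c / 2 * r) powr a = (c / 2) powr a * r powr a" by (rule powr_mult)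
    ultimately have "B * r powr a \<le> A * diameter (cyl ws) powr a"
      using A by (simp add: B_def mult.assoc)
    also have "\<dots> \<le> measure \<mu> (cyl ws)" by (rule cyl[OF ws(1)])
    also have "\<dots> \<le> measure \<mu> (ball x r)"
    proof (rule finite_measure_mono)
      show "cyl ws \<subseteq> ball x r"
      proof
        fix z assume "z \<in> cyl ws"
        then have "dist x z \<le> diameter (cyl ws)"
          using mem_stop_cyl[OF x, of "r / 2"] ws by (intro diameter_bounded_bound bounded_cyl) auto
        also have "\<dots> < r" using diameter_stop_cyl_le[of "r / 2" x] r x ws by simp
        finally show "z \<in> ball x r" by simp
      qed
    qed simp
    finally show "B * r powr a \<le> measure \<mu> (ball x r)" .
  qed
qed

section \<open>The extremal ball masses\<close>

lemma I_nonempty: "I \<noteq> {}"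
  using infinite_imp_nonempty[OF infinite_I] .

lemma ball_mass_pos: "x \<in> I \<Longrightarrow> 0 < r \<Longrightarrow> 0 < measure \<mu> (ball x r)"
  using centre_in_ball by (intro full_support) (blast intro: open_ball)+

lemma SUP_ball_mass:
  assumes "0 < r"
  shows "x \<in> I \<Longrightarrow> measure \<mu> (ball x r) \<le> (SUP x\<in>I. measure \<mu> (ball x r))"
    and "0 < (SUP x\<in>I. measure \<mu> (ball x r))"
    and "(\<And>x. x \<in> I \<Longrightarrow> measure \<mu> (ball x r) \<le> b) \<Longrightarrow> (SUP x\<in>I. measure \<mu> (ball x r)) \<le> b"
proof -
  have bdd: "bdd_above ((\<lambda>x. measure \<mu> (ball x r)) ` I)"
    using prob_le_1 by (intro bdd_aboveI2[of _ _ 1])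
  show up: "measure \<mu> (ball x r) \<le> (SUP x\<in>I. measure \<mu> (ball x r))" if "x \<in> I" for x
    using that bdd by (rule cSUP_upper)
  obtain x where "x \<in> I" using I_nonempty by blast
  then show "0 < (SUP x\<in>I. measure \<mu> (ball x r))"
    using up ball_mass_pos[OF _ assms] by fastforce
  show "(\<And>x. x \<in> I \<Longrightarrow> measure \<mu> (ball x r) \<le> b) \<Longrightarrow> (SUP x\<in>I. measure \<mu> (ball x r)) \<le> b"
    using I_nonempty by (intro cSUP_least)
qed

lemma INF_ball_mass_le:
  assumes "x \<in> I"
  shows "(INF x\<in>I. measure \<mu> (ball x r)) \<le> measure \<mu> (ball x r)"
  using assms by (intro cINF_lower bdd_belowI2[of _ 0]) auto

text \<open>
  Each ball of radius \<open>r\<close> around a point of \<open>I\<close> contains one of finitely many balls of radius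
  \<open>r / 2\<close> that cover \<open>I\<close>. Positivity matters because \<open>ln 0 = 0\<close>: were the infimum \<open>0\<close>, its
  logarithm would say nothing about the masses.
\<close>

lemma INF_ball_mass_pos:
  assumes "0 < r"
  shows "0 < (INF x\<in>I. measure \<mu> (ball x r))"
proof -
  have "I \<subseteq> (\<Union>x\<in>I. ball x (r / 2))" using assms by force
  then obtain X where X: "X \<subseteq> I" "finite X" "I \<subseteq> (\<Union>x\<in>X. ball x (r / 2))"
    using compactE_image[OF compact_I, of I "\<lambda>x. ball x (r / 2)"] by auto
  have ne: "X \<noteq> {}" using X(3) I_nonempty by auto
  define m where "m = Min ((\<lambda>x. measure \<mu> (ball x (r / 2))) ` X)"
  have "0 < m" unfolding m_def using X ne ball_mass_pos[of _ "r / 2"] assms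
    by (subst Min_gr_iff) auto
  also have "m \<le> (INF x\<in>I. measure \<mu> (ball x r))"
  proof (rule cINF_greatest[OF I_nonempty])
    fix y assume "y \<in> I"
    then obtain x where x: "x \<in> X" "dist x y < r / 2" using X(3) by auto
    have "m \<le> measure \<mu> (ball x (r / 2))" using x(1) X(2) by (auto simp: m_def)
    also have "\<dots> \<le> measure \<mu> (ball y r)"
    proof (rule finite_measure_mono)
      show "ball x (r / 2) \<subseteq> ball y r"
      proof
        fix z assume "z \<in> ball x (r / 2)"
        then show "z \<in> ball y r" using x(2) dist_triangle3[of y z x] by simp
      qed
    qed simp
    finally show "m \<le> measure \<mu> (ball y r)" .
  qed
  finally show ?thesis .
qed

section \<open>Exact power laws for cylinders\<close>

text \<open>
  Masses decay at least, and lengths at most, exponentially in the number of letters. This crude bound is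
  there to show that \<open>d\<close> is positive.
\<close>

lemma mass_le_length_powr_crude:
  obtains \<alpha> A where "0 < \<alpha>" "0 < A"
    "\<And>ws. ws \<in> lists \<P> \<Longrightarrow> measure \<mu> (cyl ws) \<le> A * diameter (cyl ws) powr \<alpha>"
proof -
  obtain \<theta> where \<theta>: "0 < \<theta>" "\<theta> < 1"
    and d: "\<And>ws P. ws \<in> lists \<P> \<Longrightarrow> P \<in> \<P> \<Longrightarrow> \<theta> * diameter (cyl ws) \<le> diameter (cyl (ws @ [P]))"
    and m: "\<And>ws P. ws \<in> lists \<P> \<Longrightarrow> P \<in> \<P> \<Longrightarrow>
      measure \<mu> (cyl (ws @ [P])) \<le> (1 - \<theta>) * measure \<mu> (cyl ws)"
    using child_bounds by metis
  define L where "L = diameter I"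
  have L: "0 < L" using diameter_cyl_pos[of "[]"] by (simp add: L_def)
  have dm: "\<theta> ^ length ws * L \<le> diameter (cyl ws) \<and> measure \<mu> (cyl ws) \<le> (1 - \<theta>) ^ length ws"
    if "ws \<in> lists \<P>" for ws
    using that
  proof (induction ws rule: rev_induct)
    case Nil
    then show ?case by (simp add: L_def)
  next
    case (snoc P ws)
    then have ws: "ws \<in> lists \<P>" "P \<in> \<P>" by auto
    have "\<theta> * (\<theta> ^ length ws * L) \<le> \<theta> * diameter (cyl ws)"
      using snoc.IH ws \<theta> by (intro mult_left_mono) auto
    also have "\<dots> \<le> diameter (cyl (ws @ [P]))" using d ws by blast
    finally have 1: "\<theta> * (\<theta> ^ length ws * L) \<le> diameter (cyl (ws @ [P]))" .
    have "measure \<mu> (cyl (ws @ [P])) \<le> (1 - \<theta>) * measure \<mu> (cyl ws)" using m ws by blast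
    also have "\<dots> \<le> (1 - \<theta>) * (1 - \<theta>) ^ length ws"
      using snoc.IH ws \<theta> by (intro mult_left_mono) auto
    finally show ?case using 1 by (simp add: mult.assoc)
  qed
  define \<alpha> where "\<alpha> = ln (1 - \<theta>) / ln \<theta>"
  have \<alpha>: "0 < \<alpha>" using \<theta> by (simp add: \<alpha>_def divide_neg_neg)
  have \<theta>\<alpha>: "\<theta> powr \<alpha> = 1 - \<theta>" using \<theta> by (simp add: \<alpha>_def powr_def)
  show ?thesis
  proof (rule that[OF \<alpha>])
    show "0 < 1 / L powr \<alpha>" using L by simp
    fix ws assume ws: "ws \<in> lists \<P>"
    let ?n = "length ws"
    have "measure \<mu> (cyl ws) \<le> (\<theta> powr \<alpha>) ^ ?n" using dm[OF ws] \<theta>\<alpha> by simp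
    also have "\<dots> = (\<theta> ^ ?n) powr \<alpha>"
      using \<theta> by (simp add: powr_powr powr_realpow[symmetric] mult.commute)
    also have "\<dots> \<le> (diameter (cyl ws) / L) powr \<alpha>"
      using dm[OF ws] \<theta> L \<alpha> by (intro powr_mono2) (auto simp: pos_le_divide_eq)
    also have "\<dots> = 1 / L powr \<alpha> * diameter (cyl ws) powr \<alpha>"
      using L diameter_cyl_pos[OF ws] by (simp add: powr_divide)
    finally show "measure \<mu> (cyl ws) \<le> 1 / L powr \<alpha> * diameter (cyl ws) powr \<alpha>" .
  qed
qed

lemma upper_exponent_pos:
  assumes lim: "((\<lambda>r. ln (SUP x\<in>I. measure \<mu> (ball x r)) / ln r) \<longlongrightarrow> d) (at_right 0)"
  shows "0 < d"
proof -
  obtain \<alpha> A where \<alpha>: "0 < \<alpha>" "0 < A" and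
    le: "\<And>ws. ws \<in> lists \<P> \<Longrightarrow> measure \<mu> (cyl ws) \<le> A * diameter (cyl ws) powr \<alpha>"
    using mass_le_length_powr_crude by metis
  obtain B where B: "0 < B" and
    ball: "\<And>x r. 0 < r \<Longrightarrow> r \<le> 1 \<Longrightarrow> measure \<mu> (ball x r) \<le> B * r powr \<alpha>"
    using ball_mass_upper[OF _ _ le] \<alpha> by (metis less_imp_le)
  have "((\<lambda>r. ln B / ln r + \<alpha>) \<longlongrightarrow> 0 + \<alpha>) (at_right 0)"
    by (intro tendsto_intros tendsto_divide_0[OF tendsto_const]
        filterlim_at_bot_imp_at_infinity ln_at_0)
  moreover have "\<forall>\<^sub>F r in at_right 0.
      ln B / ln r + \<alpha> \<le> ln (SUP x\<in>I. measure \<mu> (ball x r)) / ln r"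
  proof (rule eventually_at_rightI[of 0 1])
    fix r :: real assume r: "r \<in> {0<..<1}"
    have "ln (SUP x\<in>I. measure \<mu> (ball x r)) \<le> ln (B * r powr \<alpha>)"
      using SUP_ball_mass[of r] ball r B by (subst ln_le_cancel_iff) auto
    also have "\<dots> = ln B + \<alpha> * ln r" using B r by (simp add: ln_mult ln_powr)
    finally have "(ln B + \<alpha> * ln r) / ln r \<le> ln (SUP x\<in>I. measure \<mu> (ball x r)) / ln r"
      using r by (intro divide_right_mono_neg) auto
    then show "ln B / ln r + \<alpha> \<le> ln (SUP x\<in>I. measure \<mu> (ball x r)) / ln r"
      using r by (simp add: add_divide_distrib)
  qed simp
  ultimately have "0 + \<alpha> \<le> d" using lim
    by (intro tendsto_le[OF _ lim, rotated]) auto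
  then show ?thesis using \<alpha> by simp
qed

lemma lower_exponent_nonneg:
  assumes lim: "((\<lambda>r. ln (INF x\<in>I. measure \<mu> (ball x r)) / ln r) \<longlongrightarrow> D) (at_right 0)"
  shows "0 \<le> D"
proof (rule tendsto_lowerbound[OF lim])
  show "\<forall>\<^sub>F r in at_right 0. 0 \<le> ln (INF x\<in>I. measure \<mu> (ball x r)) / ln r"
  proof (rule eventually_at_rightI[of 0 1])
    fix r :: real assume r: "r \<in> {0<..<1}"
    obtain x where "x \<in> I" using I_nonempty by blast
    then have "(INF x\<in>I. measure \<mu> (ball x r)) \<le> 1"
      using INF_ball_mass_le prob_le_1 order_trans by blast
    then have "ln (INF x\<in>I. measure \<mu> (ball x r)) \<le> 0"
      using INF_ball_mass_pos[of r] r by simp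
    then show "0 \<le> ln (INF x\<in>I. measure \<mu> (ball x r)) / ln r"
      using r by (intro divide_nonpos_nonpos) auto
  qed simp
qed simp

text \<open>
  The exponent is shifted by one to leave out the empty word, for which the power bounds below may fail:
  \<open>I\<close> need not have length \<open>1\<close>.
\<close>

definition word_power :: "real set list \<Rightarrow> nat \<Rightarrow> real set list" where
  "word_power ws k = concat (replicate (Suc k) ws)"

lemma word_power_in_lists: "ws \<in> lists \<P> \<Longrightarrow> word_power ws k \<in> lists \<P>"
  by (auto simp: word_power_def)

lemma word_power_0: "word_power ws 0 = ws"
  and word_power_Suc: "word_power ws (Suc k) = ws @ word_power ws k"
  by (simp_all add: word_power_def)

text \<open>
  Here and in the next lemma, \<open>h\<close> stands for the length or the mass of the cylinder of a word.
\<close>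

lemma power_bound_upper:
  fixes h :: "real set list \<Rightarrow> real"
  assumes ws: "ws \<in> lists \<P>" and K: "1 \<le> K" and nn: "0 \<le> h ws"
    and sub: "\<And>us vs. us \<in> lists \<P> \<Longrightarrow> vs \<in> lists \<P> \<Longrightarrow> h (us @ vs) \<le> K * (h us * h vs)"
  shows "h (word_power ws k) \<le> (K * h ws) ^ Suc k"
proof (induction k)
  case 0
  show ?case using mult_right_mono[OF K nn] by (simp add: word_power_0)
next
  case (Suc k)
  have "h (word_power ws (Suc k)) \<le> K * h ws * h (word_power ws k)"
    using sub[OF ws word_power_in_lists[OF ws, of k]] by (simp add: word_power_Suc mult.assoc)
  also have "\<dots> \<le> K * h ws * (K * h ws) ^ Suc k"
    using Suc K nn by (intro mult_left_mono) auto
  finally show ?case by simp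
qed

lemma power_bound_lower:
  fixes h :: "real set list \<Rightarrow> real"
  assumes ws: "ws \<in> lists \<P>" and K: "1 \<le> K" and nn: "0 \<le> h ws"
    and super: "\<And>us vs. us \<in> lists \<P> \<Longrightarrow> vs \<in> lists \<P> \<Longrightarrow> h us * h vs \<le> K * h (us @ vs)"
  shows "(h ws / K) ^ Suc k \<le> h (word_power ws k)"
proof (induction k)
  case 0
  show ?case using mult_right_mono[OF K nn] K by (simp add: word_power_0 divide_le_eq mult.commute)
next
  case (Suc k)
  have "(h ws / K) ^ Suc (Suc k) = (h ws / K) * (h ws / K) ^ Suc k" by simp
  also have "\<dots> \<le> (h ws / K) * h (word_power ws k)"
    using Suc K nn by (intro mult_left_mono) auto
  also have "\<dots> \<le> h (word_power ws (Suc k))"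
    using super[OF ws word_power_in_lists[OF ws, of k]] K
    by (simp add: word_power_Suc divide_le_eq mult.commute)
  finally show ?case .
qed

lemma geometric_scale_limit:
  fixes q c :: real
  assumes lim: "(g \<longlongrightarrow> l) (at_right 0)" and q: "0 < q" "q < 1" and c: "0 < c"
  shows "(\<lambda>k. g (c * q ^ Suc k)) \<longlonglongrightarrow> l"
proof (rule filterlim_compose[OF lim])
  have "(\<lambda>k. c * q ^ Suc k) \<longlonglongrightarrow> c * 0"
    using q by (intro tendsto_mult_left LIMSEQ_Suc LIMSEQ_power_zero) auto
  then show "filterlim (\<lambda>k. c * q ^ Suc k) (at_right 0) sequentially"
    using q c by (intro tendsto_imp_filterlim_at_right) auto
qed

lemma log_ratio_limit:
  fixes q c m :: real
  assumes q: "0 < q" "q < 1" and c: "0 < c" and m: "0 < m"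
  shows "(\<lambda>k. ln (m ^ Suc k) / ln (c * q ^ Suc k)) \<longlonglongrightarrow> ln m / ln q"
proof -
  have lq: "ln q < 0" using q by simp
  have "(\<lambda>k. ln m / (ln c / real (Suc k) + ln q)) \<longlonglongrightarrow> ln m / (0 + ln q)"
    using lq LIMSEQ_Suc[OF lim_const_over_n, of "ln c"] by (intro tendsto_intros) auto
  moreover have "ln m / (ln c / real (Suc k) + ln q) = ln (m ^ Suc k) / ln (c * q ^ Suc k)" for k
  proof -
    have "ln (m ^ Suc k) = real (Suc k) * ln m" using m by (simp add: ln_realpow del: power_Suc of_nat_Suc)
    moreover have "ln (c * q ^ Suc k) = real (Suc k) * (ln c / real (Suc k) + ln q)"
      using c q by (simp add: ln_mult ln_realpow distrib_left del: of_nat_Suc power_Suc)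
    ultimately show ?thesis by (simp del: of_nat_Suc power_Suc)
  qed
  ultimately show ?thesis by simp
qed

text \<open>
  Let \<open>q\<close> be the length and \<open>m\<close> the mass of a cylinder, up to constants. The cylinder of the
  \<open>k\<close>-th power of its word has length at most \<open>q ^ k\<close> and mass at least \<open>m ^ k\<close>, so that some
  ball of radius \<open>2 * q ^ k\<close> has mass at least \<open>m ^ k\<close>. In the limit that defines \<open>d\<close> this
  yields \<open>d \<le> ln m / ln q\<close>, which is \<open>m \<le> q powr d\<close>.
\<close>

lemma mass_le_length_powr_d:
  assumes lim: "((\<lambda>r. ln (SUP x\<in>I. measure \<mu> (ball x r)) / ln r) \<longlongrightarrow> d) (at_right 0)"
  obtains A where "0 < A"
    "\<And>ws. ws \<in> lists \<P> \<Longrightarrow> measure \<mu> (cyl ws) \<le> A * diameter (cyl ws) powr d"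
proof -
  obtain K1 where K1: "1 \<le> K1" and len: "\<And>us vs. us \<in> lists \<P> \<Longrightarrow> vs \<in> lists \<P> \<Longrightarrow>
      diameter (cyl (us @ vs)) \<le> K1 * (diameter (cyl us) * diameter (cyl vs))"
    using diameter_concat by metis
  obtain K2 where K2: "1 \<le> K2" and mass: "\<And>us vs. us \<in> lists \<P> \<Longrightarrow> vs \<in> lists \<P> \<Longrightarrow>
      measure \<mu> (cyl us) * measure \<mu> (cyl vs) \<le> K2 * measure \<mu> (cyl (us @ vs))"
    and mpos: "\<And>ws. ws \<in> lists \<P> \<Longrightarrow> 0 < measure \<mu> (cyl ws)"
    using mass_concat by metis
  have d: "0 < d" using upper_exponent_pos[OF lim] .
  have key: "measure \<mu> (cyl ws) / K2 \<le> (K1 * diameter (cyl ws)) powr d" if ws: "ws \<in> lists \<P>" for ws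
  proof -
    define q m where "q = K1 * diameter (cyl ws)" and "m = measure \<mu> (cyl ws) / K2"
    have q: "0 < q" using K1 diameter_cyl_pos[OF ws] by (simp add: q_def)
    have m: "0 < m" using K2 mpos[OF ws] by (simp add: m_def)
    have m1: "m \<le> 1" using K2 order_trans[OF prob_le_1[of "cyl ws"] K2] by (simp add: m_def divide_le_eq)
    show ?thesis
    proof (cases "q < 1")
      case False
      then have "1 \<le> q powr d" using d by (intro ge_one_powr_ge_zero) auto
      then show ?thesis using m1 by (simp add: q_def m_def)
    next
      case True
      have le: "ln (SUP x\<in>I. measure \<mu> (ball x (2 * q ^ Suc k))) / ln (2 * q ^ Suc k)
          \<le> ln (m ^ Suc k) / ln (2 * q ^ Suc k)" if k: "2 * q ^ Suc k < 1" for k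
      proof -
        let ?w = "word_power ws k" and ?r = "2 * q ^ Suc k"
        have w: "?w \<in> lists \<P>" using word_power_in_lists[OF ws] .
        have "diameter (cyl ?w) \<le> q ^ Suc k" unfolding q_def
          using power_bound_upper[of ws K1 "\<lambda>ws. diameter (cyl ws)", OF ws K1 _ len] diameter_cyl_pos[OF ws] by simp
        then have small: "diameter (cyl ?w) < ?r" using q zero_less_power[OF q, of "Suc k"] by linarith
        obtain x where x: "x \<in> cyl ?w" using cyl_nonempty[OF w] by blast
        have "cyl ?w \<subseteq> ball x ?r"
        proof
          fix z assume "z \<in> cyl ?w"
          then have "dist x z \<le> diameter (cyl ?w)" using x by (intro diameter_bounded_bound bounded_cyl)
          then show "z \<in> ball x ?r" using small by simp
        qed
        have "m ^ Suc k \<le> measure \<mu> (cyl ?w)" unfolding m_def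
          using power_bound_lower[of ws K2 "\<lambda>ws. measure \<mu> (cyl ws)", OF ws K2 _ mass] by simp
        also have "\<dots> \<le> measure \<mu> (ball x ?r)"
          using \<open>cyl ?w \<subseteq> ball x ?r\<close> by (intro finite_measure_mono) auto
        also have "\<dots> \<le> (SUP x\<in>I. measure \<mu> (ball x ?r))"
          using x cyl_subset q by (intro SUP_ball_mass(1)) auto
        finally have "ln (m ^ Suc k) \<le> ln (SUP x\<in>I. measure \<mu> (ball x ?r))"
          using m by (intro ln_mono) auto
        then show ?thesis using k q by (intro divide_right_mono_neg) auto
      qed
      have "(\<lambda>k. 2 * q ^ Suc k) \<longlonglongrightarrow> 2 * 0"
        using q True by (intro tendsto_mult_left LIMSEQ_Suc LIMSEQ_power_zero) auto
      then have "\<forall>\<^sub>F k in sequentially. 2 * q ^ Suc k < 1" by (rule order_tendstoD) simp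
      then have ev: "\<forall>\<^sub>F k in sequentially.
          ln (SUP x\<in>I. measure \<mu> (ball x (2 * q ^ Suc k))) / ln (2 * q ^ Suc k)
            \<le> ln (m ^ Suc k) / ln (2 * q ^ Suc k)"
        by (rule eventually_mono) (rule le)
      have "d \<le> ln m / ln q"
        by (rule tendsto_le[OF sequentially_bot log_ratio_limit[OF q True _ m, of 2]
              geometric_scale_limit[OF lim q True, of 2] ev]) simp_all
      then have "ln m \<le> d * ln q" using q True by (simp add: neg_le_divide_eq)
      then have "exp (ln m) \<le> exp (d * ln q)" by simp
      then have "m \<le> q powr d" using m q by (simp add: powr_def)
      then show ?thesis by (simp add: q_def m_def)
    qed
  qed
  show ?thesis
  proof (rule that)
    show "0 < K2 * K1 powr d" using K1 K2 by simp
    fix ws assume ws: "ws \<in> lists \<P>"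
    have "(K1 * diameter (cyl ws)) powr d = K1 powr d * diameter (cyl ws) powr d" by (rule powr_mult)
    then show "measure \<mu> (cyl ws) \<le> K2 * K1 powr d * diameter (cyl ws) powr d"
      using key[OF ws] K2 by (simp add: divide_le_eq mult_ac)
  qed
qed

text \<open>
  The dual argument: the cylinder of the \<open>k\<close>-th power has length at least \<open>q ^ k\<close> and mass at most
  \<open>m ^ k\<close>, and it contains the ball of radius \<open>q ^ k / 2\<close> around its midpoint.
\<close>

lemma mass_ge_length_powr_D:
  assumes lim: "((\<lambda>r. ln (INF x\<in>I. measure \<mu> (ball x r)) / ln r) \<longlongrightarrow> D) (at_right 0)"
  obtains A where "0 < A"
    "\<And>ws. ws \<in> lists \<P> \<Longrightarrow> A * diameter (cyl ws) powr D \<le> measure \<mu> (cyl ws)"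
proof -
  obtain K0 where K0: "1 \<le> K0" and len0: "\<And>us vs. us \<in> lists \<P> \<Longrightarrow> vs \<in> lists \<P> \<Longrightarrow>
      diameter (cyl us) * diameter (cyl vs) \<le> K0 * diameter (cyl (us @ vs))"
    using diameter_concat by metis
  \<comment> \<open>The second entry makes \<open>q < 1\<close> below.\<close>
  define K1 where "K1 = max K0 (2 * diameter I)"
  have K1: "1 \<le> K1" "2 * diameter I \<le> K1" using K0 by (auto simp: K1_def)
  have len: "diameter (cyl us) * diameter (cyl vs) \<le> K1 * diameter (cyl (us @ vs))"
    if "us \<in> lists \<P>" "vs \<in> lists \<P>" for us vs
  proof -
    have "K0 * diameter (cyl (us @ vs)) \<le> K1 * diameter (cyl (us @ vs))"
      using diameter_ge_0[OF bounded_cyl] by (intro mult_right_mono) (auto simp: K1_def)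
    then show ?thesis using len0[OF that] by linarith
  qed
  obtain K2 where K2: "1 \<le> K2" and mass: "\<And>us vs. us \<in> lists \<P> \<Longrightarrow> vs \<in> lists \<P> \<Longrightarrow>
      measure \<mu> (cyl (us @ vs)) \<le> K2 * (measure \<mu> (cyl us) * measure \<mu> (cyl vs))"
    and mpos: "\<And>ws. ws \<in> lists \<P> \<Longrightarrow> 0 < measure \<mu> (cyl ws)"
    using mass_concat by metis
  have key: "(diameter (cyl ws) / K1) powr D \<le> K2 * measure \<mu> (cyl ws)" if ws: "ws \<in> lists \<P>" for ws
  proof -
    define q m where "q = diameter (cyl ws) / K1" and "m = K2 * measure \<mu> (cyl ws)"
    have q: "0 < q" using K1 diameter_cyl_pos[OF ws] by (simp add: q_def)
    have "diameter (cyl ws) \<le> diameter I"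
      using cyl_subset compact_imp_bounded[OF compact_I] by (rule diameter_subset)
    then have q1: "q < 1" using K1 diameter_cyl_pos[OF ws] by (simp add: q_def)
    have m: "0 < m" using K2 mpos[OF ws] by (simp add: m_def)
    have le: "ln (m ^ Suc k) / ln (1 / 2 * q ^ Suc k)
        \<le> ln (INF x\<in>I. measure \<mu> (ball x (1 / 2 * q ^ Suc k))) / ln (1 / 2 * q ^ Suc k)" for k
    proof -
      let ?w = "word_power ws k" and ?r = "1 / 2 * q ^ Suc k"
      have qk: "0 < q ^ Suc k" "q ^ Suc k < 1"
        using zero_less_power[OF q, of "Suc k"] power_Suc_less_one[of q k] q q1 by auto
      have w: "?w \<in> lists \<P>" using word_power_in_lists[OF ws] .
      have "q ^ Suc k \<le> diameter (cyl ?w)" unfolding q_def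
        using power_bound_lower[of ws K1 "\<lambda>ws. diameter (cyl ws)", OF ws K1(1) _ len] diameter_cyl_pos[OF ws] by simp
      define a b where "a = Inf (cyl ?w)" and "b = Sup (cyl ?w)"
      have ab: "b - a = diameter (cyl ?w)" "{a<..<b} \<subseteq> cyl ?w"
        unfolding a_def b_def
        using bounded_real_subset_Icc[OF bounded_cyl cyl_nonempty[OF w]]
          is_interval_contains_Ioo[OF cyl_interval[OF w] cyl_nonempty[OF w] bounded_cyl] by auto
      define x where "x = (a + b) / 2"
      have "2 * ?r \<le> b - a" using \<open>q ^ Suc k \<le> diameter (cyl ?w)\<close> ab(1) by simp
      then have "ball x ?r \<subseteq> {a<..<b}"
        unfolding x_def ball_eq_greaterThanLessThan by (auto simp: field_simps)
      then have sub: "ball x ?r \<subseteq> cyl ?w" using ab(2) by blast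
      moreover have "x \<in> ball x ?r" using qk by simp
      ultimately have "x \<in> I" using cyl_subset by blast
      then have "(INF x\<in>I. measure \<mu> (ball x ?r)) \<le> measure \<mu> (ball x ?r)" by (rule INF_ball_mass_le)
      also have "\<dots> \<le> measure \<mu> (cyl ?w)"
        using sub cyl_borel[OF w] by (intro finite_measure_mono) auto
      also have "\<dots> \<le> m ^ Suc k" unfolding m_def
        using power_bound_upper[of ws K2 "\<lambda>ws. measure \<mu> (cyl ws)", OF ws K2 _ mass] by simp
      finally have "ln (INF x\<in>I. measure \<mu> (ball x ?r)) \<le> ln (m ^ Suc k)"
        using INF_ball_mass_pos[of ?r] qk by (intro ln_mono) auto
      then show ?thesis using qk by (intro divide_right_mono_neg) auto
    qed
    have "ln m / ln q \<le> D"
      by (rule tendsto_le[OF sequentially_bot geometric_scale_limit[OF lim q q1, of "1 / 2"]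
            log_ratio_limit[OF q q1 _ m, of "1 / 2"] always_eventually[OF allI[OF le]]]) simp_all
    then have "D * ln q \<le> ln m" using q q1 by (simp add: neg_divide_le_eq)
    then have "exp (D * ln q) \<le> exp (ln m)" by simp
    then have "q powr D \<le> m" using m q by (simp add: powr_def)
    then show ?thesis by (simp add: q_def m_def)
  qed
  show ?thesis
  proof (rule that)
    show "0 < 1 / (K2 * K1 powr D)" using K1 K2 by simp
    fix ws assume ws: "ws \<in> lists \<P>"
    have "diameter (cyl ws) powr D / K1 powr D \<le> K2 * measure \<mu> (cyl ws)"
      using key[OF ws] K1 diameter_cyl_pos[OF ws] by (simp only: powr_divide)
    moreover have "0 < K1 powr D" using K1 by simp
    ultimately show "1 / (K2 * K1 powr D) * diameter (cyl ws) powr D \<le> measure \<mu> (cyl ws)"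
      using K2 by (simp add: divide_le_eq mult_ac)
  qed
qed

end

section \<open>Discretising a measure with power bounds on balls\<close>

lemma ball_subset_shrunk_ball_Un_boundary:
  fixes x y \<delta> \<eta> :: real
  assumes "\<bar>x - y\<bar> < \<eta>"
  shows "ball x \<delta> \<subseteq> ball y (\<delta> - \<eta>) \<union> (ball (y - \<delta>) (2 * \<eta>) \<union> ball (y + \<delta>) (2 * \<eta>))"
proof
  fix z assume "z \<in> ball x \<delta>"
  then have z: "x - \<delta> < z" "z < x + \<delta>" by (auto simp: ball_eq_greaterThanLessThan)
  have xy: "y - \<eta> < x" "x < y + \<eta>" using assms by linarith+
  consider "z \<le> y - (\<delta> - \<eta>)" | "y + (\<delta> - \<eta>) \<le> z" | "y - (\<delta> - \<eta>) < z \<and> z < y + (\<delta> - \<eta>)"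
    by linarith
  then show "z \<in> ball y (\<delta> - \<eta>) \<union> (ball (y - \<delta>) (2 * \<eta>) \<union> ball (y + \<delta>) (2 * \<eta>))"
    using z xy by cases (auto simp: ball_eq_greaterThanLessThan)
qed

lemma card_grid_cells:
  fixes S :: "real set"
  assumes "S \<subseteq> {-R..R}" "0 < \<eta>" "\<eta> \<le> 1"
  shows "finite ((\<lambda>x. \<lfloor>x / \<eta>\<rfloor>) ` S)"
    and "real (card ((\<lambda>x. \<lfloor>x / \<eta>\<rfloor>) ` S)) * \<eta> \<le> \<bar>2 * R + 2\<bar>"
proof -
  let ?J = "(\<lambda>x. \<lfloor>x / \<eta>\<rfloor>) ` S" and ?T = "{\<lfloor>- R / \<eta>\<rfloor>..\<lfloor>R / \<eta>\<rfloor>}"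
  have sub: "?J \<subseteq> ?T"
  proof
    fix i assume "i \<in> ?J"
    then obtain x where x: "x \<in> S" "i = \<lfloor>x / \<eta>\<rfloor>" by auto
    have "- R \<le> x" "x \<le> R" using x(1) assms(1) by auto
    then have "- R / \<eta> \<le> x / \<eta>" "x / \<eta> \<le> R / \<eta>"
      using assms(2) by (intro divide_right_mono; simp)+
    then show "i \<in> ?T" using x(2) by (simp add: floor_mono)
  qed
  then show fin: "finite ?J" by (rule finite_subset) simp
  show "real (card ?J) * \<eta> \<le> \<bar>2 * R + 2\<bar>"
  proof (cases "S = {}")
    case False
    then have R: "0 \<le> R" using assms(1) by force
    have "real (card ?J) \<le> real (card ?T)" by (rule of_nat_mono[OF card_mono[OF finite_atLeastAtMost_int sub]])
    also have "\<dots> = real_of_int (\<lfloor>R / \<eta>\<rfloor> + 1 - \<lfloor>- R / \<eta>\<rfloor>)"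
    proof -
      have "\<lfloor>- R / \<eta>\<rfloor> \<le> \<lfloor>R / \<eta>\<rfloor>" using R assms by (intro floor_mono divide_right_mono) auto
      then show ?thesis by simp
    qed
    also have "\<dots> \<le> R / \<eta> + 1 - (- R / \<eta> - 1)" by linarith
    finally have "real (card ?J) * \<eta> \<le> (R / \<eta> + 1 - (- R / \<eta> - 1)) * \<eta>"
      using assms by (intro mult_right_mono) auto
    also have "\<dots> = 2 * R + 2 * \<eta>" using assms by (simp add: field_simps)
    finally show ?thesis using assms R by simp
  qed simp
qed

text \<open>
  The cell of \<open>x\<close> is the ball of radius \<open>\<delta> - \<eta>\<close> around the largest multiple of \<open>\<eta>\<close> that is at
  most \<open>x\<close>; thus a \<open>\<delta>\<close>-ball determines its cell by a single grid point. Choosing both endpoints of an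
  interval from the grid independently would square the number of cells.
\<close>

lemma discretisation_of_power_bounds:
  fixes \<mu> :: "real measure" and I :: "real set"
  assumes "prob_space \<mu>" and sets: "sets \<mu> = sets borel" and "bounded I"
    and d: "0 < d" and c1: "0 < c1" and c2: "0 < c2"
    and lower: "\<And>x r. x \<in> I \<Longrightarrow> 0 < r \<Longrightarrow> r \<le> 1 \<Longrightarrow> c1 * r powr D \<le> measure \<mu> (ball x r)"
    and upper: "\<And>x r. 0 < r \<Longrightarrow> r \<le> 1 \<Longrightarrow> measure \<mu> (ball x r) \<le> c2 * r powr d"
  shows "\<exists>p>0. \<exists>C>0. \<forall>\<epsilon>\<in>{0<..<1}. \<forall>\<delta>\<in>{0<..<1}.
    \<exists>\<A>. multifractal_discretisation I \<mu> \<epsilon> \<delta> \<A> \<and>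
      (\<lambda>A. exp (- (p * \<delta> powr (- D) * ln (1 / \<delta>)) * measure \<mu> A)) summable_on \<A> \<and>
      (\<Sum>\<^sub>\<infinity>A\<in>\<A>. exp (- (p * \<delta> powr (- D) * ln (1 / \<delta>)) * measure \<mu> A))
        \<le> C * \<epsilon> powr (- (1 / d))"
proof -
  interpret prob_space \<mu> by fact
  obtain R where R: "0 < R" "I \<subseteq> {-R..R}"
    using \<open>bounded I\<close> unfolding bounded_pos by (force simp: abs_le_iff)
  \<comment> \<open>\<open>s \<ge> 1\<close> keeps \<open>\<eta>\<close> well below \<open>\<delta>\<close>, and \<open>s * d \<ge> D\<close> keeps \<open>\<eta> powr d\<close> below \<open>\<epsilon> * \<delta> powr D\<close>.\<close>
  define s where "s = max 1 (D / d)"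
  have s: "1 \<le> s" "D \<le> s * d" using d by (auto simp: s_def max_def field_simps)
  \<comment> \<open>So small that two intervals of radius \<open>2 * \<eta>\<close> carry at most half of the mass that may be lost.\<close>
  define \<tau> where "\<tau> = min (1 / 8) ((c1 / (4 * c2)) powr (1 / d) / 2)"
  have \<tau>: "0 < \<tau>" "\<tau> \<le> 1 / 8" "2 * \<tau> \<le> (c1 / (4 * c2)) powr (1 / d)"
    using c1 c2 by (auto simp: \<tau>_def)
  have "(2 * \<tau>) powr d \<le> ((c1 / (4 * c2)) powr (1 / d)) powr d"
    using \<tau> d by (intro powr_mono2) auto
  then have \<tau>d: "(2 * \<tau>) powr d \<le> c1 / (4 * c2)" using d c1 c2 by (simp add: powr_powr)
  \<comment> \<open>Cells have mass at least \<open>c1 / 2 * \<delta> powr D\<close>, hence weight at most \<open>\<delta> powr s\<close>.\<close>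
  define p where "p = 2 * s / c1"
  define C where "C = (2 * R + 2) / \<tau>"
  have pC: "0 < p" "0 < C" using s c1 R \<tau> by (auto simp: p_def C_def)
  show ?thesis
  proof (rule exI[of _ p], rule conjI[OF pC(1)], rule exI[of _ C], rule conjI[OF pC(2)], intro ballI)
    fix \<epsilon> \<delta> :: real assume "\<epsilon> \<in> {0<..<1}" "\<delta> \<in> {0<..<1}"
    then have \<epsilon>: "0 < \<epsilon>" "\<epsilon> < 1" and \<delta>: "0 < \<delta>" "\<delta> < 1" by auto
    define \<eta> where "\<eta> = \<tau> * (\<epsilon> powr (1 / d) * \<delta> powr s)"
    have \<eta>: "0 < \<eta>" using \<tau> \<epsilon> \<delta> by (simp add: \<eta>_def)
    have "\<epsilon> powr (1 / d) \<le> 1" using \<epsilon> d by (intro powr_le1) auto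
    moreover have "\<delta> powr s \<le> \<delta>" using powr_mono'[OF s(1), of \<delta>] \<delta> by simp
    ultimately have "\<epsilon> powr (1 / d) * \<delta> powr s \<le> 1 * \<delta>" using \<delta> by (intro mult_mono) auto
    then have "\<eta> \<le> \<tau> * (1 * \<delta>)" unfolding \<eta>_def using \<tau> by (intro mult_left_mono) auto
    also have "\<dots> \<le> 1 / 8 * (1 * \<delta>)" using \<tau> \<delta> by (intro mult_right_mono) auto
    finally have \<eta>\<delta>: "\<eta> \<le> \<delta> / 8" by simp
    have small: "measure \<mu> (ball y (2 * \<eta>)) \<le> \<epsilon> / 4 * (c1 * \<delta> powr D)" for y
    proof -
      have "measure \<mu> (ball y (2 * \<eta>)) \<le> c2 * (2 * \<eta>) powr d"
        using \<eta> \<eta>\<delta> \<delta> by (intro upper) auto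
      also have "(2 * \<eta>) powr d = (2 * \<tau>) powr d * (\<epsilon> * \<delta> powr (s * d))"
      proof -
        have "2 * \<eta> = (2 * \<tau>) * (\<epsilon> powr (1 / d) * \<delta> powr s)" by (simp add: \<eta>_def)
        then have "(2 * \<eta>) powr d =
            (2 * \<tau>) powr d * ((\<epsilon> powr (1 / d)) powr d * (\<delta> powr s) powr d)"
          by (simp only: powr_mult)
        then show ?thesis using d \<epsilon> by (simp add: powr_powr)
      qed
      also have "(2 * \<tau>) powr d * (\<epsilon> * \<delta> powr (s * d)) \<le> c1 / (4 * c2) * (\<epsilon> * \<delta> powr D)"
      proof (rule mult_mono[OF \<tau>d])
        have "\<delta> powr (s * d) \<le> \<delta> powr D" using powr_mono'[OF s(2), of \<delta>] \<delta> by simp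
        then show "\<epsilon> * \<delta> powr (s * d) \<le> \<epsilon> * \<delta> powr D" using \<epsilon> by simp
      qed (use c1 c2 \<epsilon> in auto)
      also have "c2 * (c1 / (4 * c2) * (\<epsilon> * \<delta> powr D)) = \<epsilon> / 4 * (c1 * \<delta> powr D)"
        using c2 by simp
      finally show ?thesis using c2 by simp
    qed
    define cell where "cell i = ball (real_of_int i * \<eta>) (\<delta> - \<eta>)" for i
    define J where "J = (\<lambda>x. \<lfloor>x / \<eta>\<rfloor>) ` I"
    have near: "\<bar>x - real_of_int \<lfloor>x / \<eta>\<rfloor> * \<eta>\<bar> < \<eta>" for x
    proof -
      have "real_of_int \<lfloor>x / \<eta>\<rfloor> \<le> x / \<eta>" "x / \<eta> < real_of_int \<lfloor>x / \<eta>\<rfloor> + 1" by linarith+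
      then have "real_of_int \<lfloor>x / \<eta>\<rfloor> * \<eta> \<le> x" "x < (real_of_int \<lfloor>x / \<eta>\<rfloor> + 1) * \<eta>"
        using \<eta> by (simp_all only: pos_le_divide_eq pos_divide_less_eq)
      then show ?thesis by (simp add: algebra_simps)
    qed
    have most: "(1 - \<epsilon> / 2) * measure \<mu> (ball x \<delta>) \<le> measure \<mu> (cell \<lfloor>x / \<eta>\<rfloor>)" if x: "x \<in> I" for x
    proof -
      let ?y = "real_of_int \<lfloor>x / \<eta>\<rfloor> * \<eta>"
      let ?E = "ball (?y - \<delta>) (2 * \<eta>)" and ?F = "ball (?y + \<delta>) (2 * \<eta>)"
      have "measure \<mu> (ball x \<delta>) \<le> measure \<mu> (cell \<lfloor>x / \<eta>\<rfloor> \<union> (?E \<union> ?F))"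
        unfolding cell_def using sets
        by (intro finite_measure_mono ball_subset_shrunk_ball_Un_boundary near) auto
      also have "\<dots> \<le> measure \<mu> (cell \<lfloor>x / \<eta>\<rfloor>) + measure \<mu> (?E \<union> ?F)"
        using sets by (intro measure_Un_le) (auto simp: cell_def)
      also have "\<dots> \<le> measure \<mu> (cell \<lfloor>x / \<eta>\<rfloor>) + (measure \<mu> ?E + measure \<mu> ?F)"
        using sets by (intro add_left_mono measure_Un_le) auto
      also have "\<dots> \<le> measure \<mu> (cell \<lfloor>x / \<eta>\<rfloor>) + \<epsilon> / 2 * (c1 * \<delta> powr D)"
        using small[of "?y - \<delta>"] small[of "?y + \<delta>"] by simp
      also have "\<dots> \<le> measure \<mu> (cell \<lfloor>x / \<eta>\<rfloor>) + \<epsilon> / 2 * measure \<mu> (ball x \<delta>)"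
        using lower[OF x, of \<delta>] \<delta> \<epsilon> by (intro add_left_mono mult_left_mono) auto
      finally show ?thesis by (simp add: algebra_simps)
    qed
    have disc: "multifractal_discretisation I \<mu> \<epsilon> \<delta> (cell ` J)"
      unfolding multifractal_discretisation_def
    proof (intro conjI ballI)
      fix A assume "A \<in> cell ` J"
      then obtain i where "A = cell i" by auto
      then show "A \<in> sets borel" "bounded A \<longrightarrow> \<delta> / 2 \<le> diameter A"
        using \<eta>\<delta> \<delta> by (auto simp: cell_def diameter_ball)
    next
      fix x assume x: "x \<in> I"
      have pos: "0 < measure \<mu> (ball x \<delta>)"
        using lower[OF x, of \<delta>] \<delta> c1 by (smt (verit) mult_pos_pos powr_gt_zero)
      show "\<exists>A\<in>cell ` J. A \<subseteq> ball x \<delta> \<and> 1 - \<epsilon> \<le> measure \<mu> A / measure \<mu> (ball x \<delta>)"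
      proof (intro bexI conjI)
        show "cell \<lfloor>x / \<eta>\<rfloor> \<in> cell ` J" using x by (auto simp: J_def)
        show "cell \<lfloor>x / \<eta>\<rfloor> \<subseteq> ball x \<delta>"
        proof
          fix z assume "z \<in> cell \<lfloor>x / \<eta>\<rfloor>"
          then show "z \<in> ball x \<delta>"
            using near[of x] unfolding cell_def mem_ball dist_real_def by linarith
        qed
        have "(1 - \<epsilon>) * measure \<mu> (ball x \<delta>) \<le> (1 - \<epsilon> / 2) * measure \<mu> (ball x \<delta>)"
          using \<epsilon> pos by (intro mult_right_mono) auto
        also note most[OF x]
        finally show "1 - \<epsilon> \<le> measure \<mu> (cell \<lfloor>x / \<eta>\<rfloor>) / measure \<mu> (ball x \<delta>)"
          by (simp only: pos_le_divide_eq[OF pos])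
      qed
    qed
    let ?w = "\<lambda>A. exp (- (p * \<delta> powr (- D) * ln (1 / \<delta>)) * measure \<mu> A)"
    have weight: "?w A \<le> \<delta> powr s" if A: "A \<in> cell ` J" for A
    proof -
      obtain x where x: "x \<in> I" "A = cell \<lfloor>x / \<eta>\<rfloor>" using A by (auto simp: J_def)
      have "1 / 2 * (c1 * \<delta> powr D) \<le> (1 - \<epsilon> / 2) * measure \<mu> (ball x \<delta>)"
        using lower[OF x(1), of \<delta>] \<delta> \<epsilon> c1 by (intro mult_mono) auto
      then have heavy: "c1 / 2 * \<delta> powr D \<le> measure \<mu> A" using most[OF x(1)] x(2) by simp
      have ln: "0 < ln (1 / \<delta>)" using \<delta> by simp
      have "s * ln (1 / \<delta>) = p * \<delta> powr (- D) * ln (1 / \<delta>) * (c1 / 2 * \<delta> powr D)"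
        using c1 \<delta> by (simp add: p_def powr_minus)
      also have "\<dots> \<le> p * \<delta> powr (- D) * ln (1 / \<delta>) * measure \<mu> A"
        using heavy pC(1) ln by (intro mult_left_mono) auto
      finally have "?w A \<le> exp (- (s * ln (1 / \<delta>)))" by simp
      also have "\<dots> = \<delta> powr s" using \<delta> by (simp add: powr_def ln_div)
      finally show ?thesis .
    qed
    have grid: "finite J" "real (card J) * \<eta> \<le> 2 * R + 2"
      using card_grid_cells[OF R(2) \<eta>] \<eta>\<delta> \<delta> R(1) by (auto simp: J_def)
    have "(\<Sum>\<^sub>\<infinity>A\<in>cell ` J. ?w A) = (\<Sum>A\<in>cell ` J. ?w A)" using grid(1) by simp
    also have "\<dots> \<le> real (card (cell ` J)) * \<delta> powr s"
      using sum_mono[OF weight, of "cell ` J"] by simp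
    also have "\<dots> \<le> real (card J) * \<delta> powr s"
      using card_image_le[OF grid(1), of cell] by (intro mult_right_mono) auto
    also have "\<dots> = real (card J) * \<eta> * (\<epsilon> powr (- (1 / d)) / \<tau>)"
      using \<tau> \<epsilon> by (simp add: \<eta>_def powr_minus field_simps)
    also have "\<dots> \<le> (2 * R + 2) * (\<epsilon> powr (- (1 / d)) / \<tau>)"
      using grid(2) \<tau> by (intro mult_right_mono) auto
    also have "\<dots> = C * \<epsilon> powr (- (1 / d))" by (simp add: C_def)
    finally show "\<exists>\<A>. multifractal_discretisation I \<mu> \<epsilon> \<delta> \<A> \<and> ?w summable_on \<A> \<and>
        (\<Sum>\<^sub>\<infinity>A\<in>\<A>. ?w A) \<le> C * \<epsilon> powr (- (1 / d))"
      using disc grid(1) by (intro exI[of _ "cell ` J"]) auto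
  qed
qed

theorem proposition2p3:
  fixes I :: "real set" and \<P> :: "real set set" and f \<phi> :: "real \<Rightarrow> real"
    and \<mu> :: "real measure" and d D :: real
  assumes "gibbs_system I \<P> f \<phi> \<mu>"
    and "((\<lambda>r. ln (SUP x\<in>I. measure \<mu> (ball x r)) / ln r) \<longlongrightarrow> d) (at_right 0)"
    and "((\<lambda>r. ln (INF x\<in>I. measure \<mu> (ball x r)) / ln r) \<longlongrightarrow> D) (at_right 0)"
  shows "\<exists>p>0. \<exists>C>0. \<forall>\<epsilon>\<in>{0<..<1}. \<forall>\<delta>\<in>{0<..<1}.
    \<exists>\<A>. multifractal_discretisation I \<mu> \<epsilon> \<delta> \<A> \<and>
      (\<lambda>A. exp (- (p * \<delta> powr (- D) * ln (1 / \<delta>)) * measure \<mu> A)) summable_on \<A> \<and>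
      (\<Sum>\<^sub>\<infinity>A\<in>\<A>. exp (- (p * \<delta> powr (- D) * ln (1 / \<delta>)) * measure \<mu> A))
        \<le> C * \<epsilon> powr (- (1 / d))"
proof -
  interpret gibbs_system I \<P> f \<phi> \<mu> by fact
  have d: "0 < d" using assms(2) by (rule upper_exponent_pos)
  have D: "0 \<le> D" using assms(3) by (rule lower_exponent_nonneg)
  obtain A1 where A1: "0 < A1"
    "\<And>ws. ws \<in> lists \<P> \<Longrightarrow> measure \<mu> (cyl ws) \<le> A1 * diameter (cyl ws) powr d"
    using mass_le_length_powr_d[OF assms(2)] by metis
  obtain c2 where c2: "0 < c2" "\<And>x r. 0 < r \<Longrightarrow> r \<le> 1 \<Longrightarrow> measure \<mu> (ball x r) \<le> c2 * r powr d"
    using ball_mass_upper[OF less_imp_le[OF d] less_imp_le[OF A1(1)] A1(2)] by metis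
  obtain A2 where A2: "0 < A2"
    "\<And>ws. ws \<in> lists \<P> \<Longrightarrow> A2 * diameter (cyl ws) powr D \<le> measure \<mu> (cyl ws)"
    using mass_ge_length_powr_D[OF assms(3)] by metis
  obtain c1 where c1: "0 < c1"
    "\<And>x r. x \<in> I \<Longrightarrow> 0 < r \<Longrightarrow> r \<le> 1 \<Longrightarrow> c1 * r powr D \<le> measure \<mu> (ball x r)"
    using ball_mass_lower[OF D A2] by metis
  show ?thesis
    by (rule discretisation_of_power_bounds[OF prob(1,2) compact_imp_bounded[OF compact_I] d c1(1)
        c2(1) c1(2) c2(2)])
qed

end
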